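(* Let $n\geq 1$ and $\sigma\in S_n$. The graph $\mathcal{B}(\sigma)$ is planar if and only if it is (isomorphic, as an undirected graph, to) a single point, a single edge, the edge graph of a square, or the edge graph of a (3-dimensional) cube.
   Context: The length $\ell(\pi)$ of $\pi\in S_n$ is the minimum number of adjacent transpositions $(i\ i+1)$ whose product is $\pi$; equivalently, it is the number of inversions, i.e. pairs $i<j$ with $\pi(i)>\pi(j)$. For $\sigma,\tau\in S_n$ write $\sigma\prec\tau$ if $\ell(\sigma)<\ell(\tau)$ and there is a transposition $t=(i\ j)$ (not necessarily adjacent) with $\sigma=\tau t$. Bruhat order $\leq$ on $S_n$ is the reflexive transitive closure of $\prec$. The Bruhat graph of $S_n$ is the directed graph with vertex set $S_n$ and an edge $\sigma\to\tau$ whenever $\sigma\prec\tau$ (the difference $\ell(\tau)-\ell(\sigma)$ need not be $1$). For $\pi\in S_n$, the Bruhat graph $\mathcal{B}(\pi)$ is the induced subgraph on the vertices $\sigma\in S_n$ with $\sigma\leq\pi$ in Bruhat order. A graph is planar if it can be drawn in the plane without edges crossing; for $\mathcal{B}(\sigma)$ this refers to the underlying undirected graph. *)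

theory Defs
  imports
    "HOL-Analysis.Analysis"
    "HOL-Combinatorics.Permutations"
    "Graph_Theory.Pair_Digraph"
    "Graph_Theory.Digraph_Isomorphism"
begin

text \<open>
  The symmetric group \<open>S\<^sub>n\<close> consists of the \<open>\<pi> :: nat \<Rightarrow> nat\<close> with \<^term>\<open>\<pi> permutes {1..n}\<close>,
  and the product \<open>\<sigma>\<tau>\<close> is the composition \<^term>\<open>\<sigma> \<circ> \<tau>\<close>.
\<close>

definition adj_word_prod :: "nat list \<Rightarrow> nat \<Rightarrow> nat" where
  "adj_word_prod is = foldr (\<circ>) (map (\<lambda>i. Transposition.transpose i (Suc i)) is) id"

definition perm_length :: "nat \<Rightarrow> (nat \<Rightarrow> nat) \<Rightarrow> nat" where
  "perm_length n \<pi> =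
     (LEAST k. \<exists>is. length is = k \<and> set is \<subseteq> {1..<n} \<and> \<pi> = adj_word_prod is)"

definition bruhat_step :: "nat \<Rightarrow> (nat \<Rightarrow> nat) \<Rightarrow> (nat \<Rightarrow> nat) \<Rightarrow> bool" where
  "bruhat_step n \<sigma> \<tau> \<longleftrightarrow>
     \<sigma> permutes {1..n} \<and> \<tau> permutes {1..n} \<and>
     perm_length n \<sigma> < perm_length n \<tau> \<and>
     (\<exists>i\<in>{1..n}. \<exists>j\<in>{1..n}. i \<noteq> j \<and> \<sigma> = \<tau> \<circ> Transposition.transpose i j)"

definition bruhat_le :: "nat \<Rightarrow> (nat \<Rightarrow> nat) \<Rightarrow> (nat \<Rightarrow> nat) \<Rightarrow> bool" where
  "bruhat_le n = (bruhat_step n)\<^sup>*\<^sup>*"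

definition bruhat_graph :: "nat \<Rightarrow> (nat \<Rightarrow> nat) pair_pre_digraph" where
  "bruhat_graph n =
     \<lparr> pverts = {\<sigma>. \<sigma> permutes {1..n}}, parcs = {(\<sigma>, \<tau>). bruhat_step n \<sigma> \<tau>} \<rparr>"

definition lower_bruhat_graph ::
  "nat \<Rightarrow> (nat \<Rightarrow> nat) \<Rightarrow> (nat \<Rightarrow> nat, (nat \<Rightarrow> nat) \<times> (nat \<Rightarrow> nat)) pre_digraph" where
  "lower_bruhat_graph n \<pi> =
     with_proj (bruhat_graph n) \<restriction> {\<sigma>. \<sigma> permutes {1..n} \<and> bruhat_le n \<sigma> \<pi>}"

text \<open>
  Undirected graphs are represented by symmetric digraphs; \<^const>\<open>mk_symmetric\<close> yields the
  underlying undirected graph of a digraph.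
\<close>

definition undirected_iso :: "('a, 'b) pre_digraph \<Rightarrow> ('c, 'd) pre_digraph \<Rightarrow> bool" where
  "undirected_iso G H \<longleftrightarrow>
     digraph_iso (with_proj (mk_symmetric G)) (with_proj (mk_symmetric H))"

text \<open>
  A crossing-free drawing in the plane: \<open>p\<close> places the vertices, and \<open>\<gamma> {u, v}\<close> is the simple arc
  drawn for the undirected edge \<open>{u, v}\<close>, so the two arcs \<open>(u, v)\<close> and \<open>(v, u)\<close> of a symmetric
  digraph share one curve. An arc meets the vertices only in its two ends, and two different
  edges meet only in the images of their common end vertices.
  The notion is meant for graphs without loops: \<^const>\<open>arc\<close> excludes closed curves.
\<close>

definition planar_drawing ::
  "'a pair_pre_digraph \<Rightarrow> ('a \<Rightarrow> complex) \<Rightarrow> ('a set \<Rightarrow> real \<Rightarrow> complex) \<Rightarrow> bool" where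
  "planar_drawing G p \<gamma> \<longleftrightarrow>
     inj_on p (pverts G) \<and>
     (\<forall>(u, v) \<in> parcs G.
        arc (\<gamma> {u, v}) \<and>
        {pathstart (\<gamma> {u, v}), pathfinish (\<gamma> {u, v})} = {p u, p v} \<and>
        path_image (\<gamma> {u, v}) \<inter> p ` pverts G = {p u, p v}) \<and>
     (\<forall>(u, v) \<in> parcs G. \<forall>(x, y) \<in> parcs G. {u, v} \<noteq> {x, y} \<longrightarrow>
        path_image (\<gamma> {u, v}) \<inter> path_image (\<gamma> {x, y}) \<subseteq> p ` ({u, v} \<inter> {x, y}))"

definition planar :: "('a, 'b) pre_digraph \<Rightarrow> bool" where
  "planar G \<longleftrightarrow> (\<exists>p \<gamma>. planar_drawing (mk_symmetric G) p \<gamma>)"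

definition point_graph :: "int pair_pre_digraph" where
  "point_graph = \<lparr> pverts = {0}, parcs = {} \<rparr>"

definition edge_graph :: "int pair_pre_digraph" where
  "edge_graph = \<lparr> pverts = {0, 1}, parcs = {(0, 1)} \<rparr>"

definition square_graph :: "(int \<times> int) pair_pre_digraph" where
  "square_graph =
     \<lparr> pverts = {0, 1} \<times> {0, 1},
       parcs = {((a, b), (a', b')). {a, b, a', b'} \<subseteq> {0, 1} \<and> \<bar>a - a'\<bar> + \<bar>b - b'\<bar> = 1} \<rparr>"

definition cube_graph :: "(int \<times> int \<times> int) pair_pre_digraph" where
  "cube_graph =
     \<lparr> pverts = {0, 1} \<times> {0, 1} \<times> {0, 1},
       parcs = {((a, b, c), (a', b', c')).
         {a, b, c, a', b', c'} \<subseteq> {0, 1} \<and> \<bar>a - a'\<bar> + \<bar>b - b'\<bar> + \<bar>c - c'\<bar> = 1} \<rparr>"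

end

theory Submission
  imports Defs "HOL-Library.Sublist"
begin

text \<open>
  Let \<open>w\<close> be a reduced word for \<open>\<sigma>\<close>. If a letter \<open>i\<close> occurs twice in \<open>w\<close>, then between the two
  occurrences there is a neighbour \<open>j = i \<plusminus> 1\<close>, as otherwise they would cancel; by the subword property
  all of the copy of \<open>S\<^sub>3\<close> generated by the two letters lies below \<open>\<sigma>\<close>, and its Bruhat graph is
  complete bipartite on 3 + 3 vertices. If all letters are distinct, then by the strong exchange
  condition the elements below \<open>\<sigma>\<close> are the subwords of \<open>w\<close>, and the Bruhat graph is the cube whose
  dimension is the length of \<open>w\<close>. The cube of dimension 4 contains a subdivision of the complete
  bipartite graph; dimensions 0 to 3 give the four planar graphs.

  That the complete bipartite graph is not planar follows from the Jordan curve theorem: two of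
  the three long diagonals of a Hamiltonian hexagon would lie on the same side of it. Diagonals
  outside the hexagon are brought inside by an inversion.
\<close>

section \<open>Words, strong exchange and the subword property\<close>

text \<open>Products are compositions, so letters act on values from the left, while the
  transpositions of Bruhat steps act on positions from the right. Strong exchange translates between
  the two, and it holds for arbitrary words: whenever a < b is an inversion of a product, the
  transposition (a b) can be absorbed by deleting one letter. Hence inversions are never counted;
  the length stays the least length of a word throughout. For words without repetition the letters
  can be recovered from the permutation by asking which initial segments it fails to preserve. This
  one invariant shows both that such words are reduced and that different subwords have different
  products. Inside and outside of a closed curve do not play symmetric roles in the plane, and the
  splitting of a region by a chord is applied to the inside only; this is why the inversion is
  needed. All nonplanarity arguments end in one statement about nine arcs, and all planarity
  arguments in one drawing of the cube.\<close>

lemma adj_word_prod_Nil [simp]: "adj_word_prod [] = id"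
  by (simp add: adj_word_prod_def)

lemma adj_word_prod_Cons [simp]:
  "adj_word_prod (i # is) = Transposition.transpose i (Suc i) \<circ> adj_word_prod is"
  by (simp add: adj_word_prod_def)

lemma adj_word_prod_append [simp]:
  "adj_word_prod (is @ js) = adj_word_prod is \<circ> adj_word_prod js"
  by (induction "is") (auto simp: comp_assoc)

lemma bij_adj_word_prod: "bij (adj_word_prod is)"
proof (induction "is")
  case Nil
  show ?case unfolding adj_word_prod_Nil by (rule bij_id)
next
  case (Cons i "is")
  then show ?case unfolding adj_word_prod_Cons by (intro bij_comp bij_transpose)
qed

lemma adj_word_prod_permutes:
  "set is \<subseteq> {1..<n} \<Longrightarrow> adj_word_prod is permutes {1..n}"
proof (induction "is")
  case (Cons i "is")
  then have "Transposition.transpose i (Suc i) permutes {1..n}"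
    by (intro permutes_swap_id) auto
  with Cons show ?case
    unfolding adj_word_prod_Cons by (intro permutes_compose) auto
qed (simp add: permutes_id)

lemma transpose_adj_word:
  assumes "1 \<le> a" "a < b" "b \<le> n"
  shows "\<exists>is. set is \<subseteq> {1..<n} \<and> Transposition.transpose a b = adj_word_prod is"
proof -
  have "Suc a \<le> b" using assms by simp
  then show ?thesis using assms(1,3)
  proof (induction b rule: dec_induct)
    case base
    then show ?case by (intro exI [of _ "[a]"]) auto
  next
    case (step b)
    then obtain "is" where "is": "set is \<subseteq> {1..<n}" "Transposition.transpose a b = adj_word_prod is"
      by auto
    have "Transposition.transpose a (Suc b) =
        Transposition.transpose b (Suc b) \<circ> Transposition.transpose a b \<circ> Transposition.transpose b (Suc b)"
      using step by (auto simp: fun_eq_iff Transposition.transpose_def)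
    with "is" step show ?case
      by (intro exI [of _ "[b] @ is @ [b]"]) (auto simp: comp_assoc)
  qed
qed

lemma adj_word_exists:
  assumes "\<sigma> permutes {1..n}"
  shows "\<exists>is. set is \<subseteq> {1..<n} \<and> \<sigma> = adj_word_prod is"
proof -
  have "finite {1..n}" by simp
  with assms show ?thesis
  proof (induction rule: permutes_induct)
    case id
    show ?case by (intro exI [of _ "[]"]) auto
  next
    case (swap a b p)
    then obtain js where js: "set js \<subseteq> {1..<n}" "p = adj_word_prod js" by auto
    have "\<exists>is. set is \<subseteq> {1..<n} \<and> Transposition.transpose a b = adj_word_prod is"
      using transpose_adj_word [of a b n] transpose_adj_word [of b a n] swap
      by (cases a b rule: linorder_cases) (auto simp: transpose_commute simp del: One_nat_def)
    then obtain "is" where "set is \<subseteq> {1..<n}" "Transposition.transpose a b = adj_word_prod is" by auto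
    with js show ?case by (intro exI [of _ "is @ js"]) auto
  qed
qed

lemma perm_length_le:
  "set is \<subseteq> {1..<n} \<Longrightarrow> perm_length n (adj_word_prod is) \<le> length is"
  unfolding perm_length_def by (rule Least_le) auto

lemma perm_length_word:
  assumes "\<sigma> permutes {1..n}"
  obtains "is" where "set is \<subseteq> {1..<n}" "\<sigma> = adj_word_prod is" "length is = perm_length n \<sigma>"
proof -
  have "\<exists>k is. length is = k \<and> set is \<subseteq> {1..<n} \<and> \<sigma> = adj_word_prod is"
    using adj_word_exists [OF assms] by auto
  from LeastI_ex [OF this] that show thesis unfolding perm_length_def by blast
qed

definition reduced_word :: "nat \<Rightarrow> nat list \<Rightarrow> bool" where
  "reduced_word n is \<longleftrightarrow> set is \<subseteq> {1..<n} \<and> perm_length n (adj_word_prod is) = length is"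

text \<open>Letters act from right to left, and the letter i changes the order of two values only if
  they are i and Suc i. The letter at which the images of a and b come out of order therefore meets
  exactly these two values, and omitting it has the same effect as swapping a and b
  beforehand.\<close>

lemma strong_exchange:
  assumes "a < b" "adj_word_prod is b < adj_word_prod is a"
  shows "\<exists>xs i ys. is = xs @ i # ys \<and>
           adj_word_prod is \<circ> Transposition.transpose a b = adj_word_prod (xs @ ys)"
  using assms
proof (induction "is")
  case (Cons i "is")
  show ?case
  proof (cases "adj_word_prod is b < adj_word_prod is a")
    case True
    then obtain xs j ys where "is = xs @ j # ys"
      "adj_word_prod is \<circ> Transposition.transpose a b = adj_word_prod (xs @ ys)"
      using Cons.IH [OF \<open>a < b\<close>] by blast
    then have "i # is = (i # xs) @ j # ys \<and>
        adj_word_prod (i # is) \<circ> Transposition.transpose a b = adj_word_prod ((i # xs) @ ys)"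
      by (simp add: comp_assoc)
    then show ?thesis by blast
  next
    case False
    have inj: "inj (adj_word_prod is)" using bij_adj_word_prod bij_betw_def by blast
    with \<open>a < b\<close> have "adj_word_prod is a \<noteq> adj_word_prod is b" by (auto dest: injD)
    with False Cons.prems have eq: "adj_word_prod is a = i" "adj_word_prod is b = Suc i"
      by (auto simp: Transposition.transpose_def split: if_splits)
    have "adj_word_prod (i # is) \<circ> Transposition.transpose a b = adj_word_prod is"
    proof
      fix x
      have "adj_word_prod is x = i \<longleftrightarrow> x = a" "adj_word_prod is x = Suc i \<longleftrightarrow> x = b"
        using inj_eq [OF inj] eq by metis+
      then show "(adj_word_prod (i # is) \<circ> Transposition.transpose a b) x = adj_word_prod is x"
        using eq by (simp add: Transposition.transpose_def)
    qed
    then show ?thesis by (metis append_Nil)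
  qed
qed auto

section \<open>Length, inversions and Bruhat steps\<close>

lemma perm_length_transpose_less:
  assumes "\<tau> permutes {1..n}" "a < b" "\<tau> b < \<tau> a"
  shows "perm_length n (\<tau> \<circ> Transposition.transpose a b) < perm_length n \<tau>"
proof -
  obtain "is" where "is": "set is \<subseteq> {1..<n}" "\<tau> = adj_word_prod is" "length is = perm_length n \<tau>"
    using perm_length_word assms by blast
  with strong_exchange [of a b "is"] assms obtain xs i ys where
    "is = xs @ i # ys" "\<tau> \<circ> Transposition.transpose a b = adj_word_prod (xs @ ys)" by auto
  with "is" perm_length_le [of "xs @ ys" n] show ?thesis by auto
qed

text \<open>For the converse: if a < b is not an inversion of \<tau>, it is one after the swap, so
  swapping back shortens and \<tau> is the shorter of the two.\<close>

lemma perm_length_transpose_less_iff: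
  assumes "\<tau> permutes {1..n}" "a \<in> {1..n}" "b \<in> {1..n}" "a < b"
  shows "perm_length n (\<tau> \<circ> Transposition.transpose a b) < perm_length n \<tau> \<longleftrightarrow> \<tau> b < \<tau> a"
proof
  assume *: "perm_length n (\<tau> \<circ> Transposition.transpose a b) < perm_length n \<tau>"
  have "\<tau> a \<noteq> \<tau> b" using assms permutes_inj [OF assms(1)] by (auto dest: injD)
  moreover have False if "\<tau> a < \<tau> b"
  proof -
    have "\<tau> \<circ> Transposition.transpose a b permutes {1..n}"
      using assms by (intro permutes_compose permutes_swap_id) auto
    from perm_length_transpose_less [OF this \<open>a < b\<close>] that *
    show False by (simp add: comp_assoc)
  qed
  ultimately show "\<tau> b < \<tau> a" by force
qed (use assms perm_length_transpose_less in blast)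

lemma bruhat_stepE:
  assumes "bruhat_step n \<sigma> \<tau>"
  obtains a b where "\<sigma> permutes {1..n}" "\<tau> permutes {1..n}" "a \<in> {1..n}" "b \<in> {1..n}" "a < b"
    "\<sigma> a < \<sigma> b" "\<sigma> = \<tau> \<circ> Transposition.transpose a b" "\<tau> = \<sigma> \<circ> Transposition.transpose a b"
    "\<tau> b < \<tau> a"
proof -
  obtain i j where ij: "\<sigma> permutes {1..n}" "\<tau> permutes {1..n}" "i \<in> {1..n}" "j \<in> {1..n}" "i \<noteq> j"
    "\<sigma> = \<tau> \<circ> Transposition.transpose i j" "perm_length n \<sigma> < perm_length n \<tau>"
    using assms unfolding bruhat_step_def by blast
  obtain a b where ab: "a \<in> {1..n}" "b \<in> {1..n}" "a < b" "\<sigma> = \<tau> \<circ> Transposition.transpose a b"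
  proof (cases "i < j")
    case True
    show ?thesis by (rule that [OF ij(3,4) True ij(6)])
  next
    case False
    with ij(5) have "j < i" by simp
    show ?thesis by (rule that [OF ij(4,3) \<open>j < i\<close>]) (simp add: ij(6) transpose_commute)
  qed
  have less: "\<tau> b < \<tau> a"
    using perm_length_transpose_less_iff [OF ij(2) ab(1-3)] ij(7) unfolding ab(4) by blast
  show thesis
  proof (rule that [OF ij(1,2) ab(1-3) _ ab(4) _ less])
    show "\<sigma> a < \<sigma> b" using less unfolding ab(4) by simp
    show "\<tau> = \<sigma> \<circ> Transposition.transpose a b" unfolding ab(4) by (simp add: comp_assoc)
  qed
qed

lemma bruhat_step_transposeI:
  assumes "\<sigma> permutes {1..n}" "a \<in> {1..n}" "b \<in> {1..n}" "a < b" "\<sigma> a < \<sigma> b"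
  shows "bruhat_step n \<sigma> (\<sigma> \<circ> Transposition.transpose a b)"
proof -
  let ?\<tau> = "\<sigma> \<circ> Transposition.transpose a b"
  have "?\<tau> permutes {1..n}" using assms by (intro permutes_compose permutes_swap_id) auto
  moreover have "\<sigma> = ?\<tau> \<circ> Transposition.transpose a b" by (simp add: comp_assoc)
  moreover have "perm_length n \<sigma> < perm_length n ?\<tau>"
    using perm_length_transpose_less [OF calculation(1) \<open>a < b\<close>] assms(5) by (simp add: comp_assoc)
  moreover have "\<exists>i\<in>{1..n}. \<exists>j\<in>{1..n}. i \<noteq> j \<and> \<sigma> = ?\<tau> \<circ> Transposition.transpose i j"
    using assms(2-4) calculation(2) by (metis less_irrefl)
  ultimately show ?thesis using assms(1) unfolding bruhat_step_def by simp
qed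

text \<open>In the undirected graph the direction of a step is irrelevant, so multiplying by any
  transposition gives an edge. The edges among the six elements of \<open>S_3\<close> come from
  here.\<close>

lemma bruhat_step_transpose_cases:
  assumes "\<sigma> permutes {1..n}" "a \<in> {1..n}" "b \<in> {1..n}" "a \<noteq> b"
  shows "bruhat_step n \<sigma> (\<sigma> \<circ> Transposition.transpose a b) \<or>
         bruhat_step n (\<sigma> \<circ> Transposition.transpose a b) \<sigma>"
proof -
  have *: "bruhat_step n \<sigma> (\<sigma> \<circ> Transposition.transpose a b) \<or>
         bruhat_step n (\<sigma> \<circ> Transposition.transpose a b) \<sigma>"
    if "a < b" "a \<in> {1..n}" "b \<in> {1..n}" for a b
  proof -
    have "\<sigma> a \<noteq> \<sigma> b" using that permutes_inj [OF assms(1)] by (auto dest: injD)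
    then consider "\<sigma> a < \<sigma> b" | "\<sigma> b < \<sigma> a" by force
    then show ?thesis
    proof cases
      case 1 then show ?thesis using bruhat_step_transposeI assms that by blast
    next
      case 2
      have "\<sigma> \<circ> Transposition.transpose a b permutes {1..n}"
        using that assms by (intro permutes_compose permutes_swap_id) auto
      from bruhat_step_transposeI [OF this that(2,3,1)] 2 show ?thesis by (simp add: comp_assoc)
    qed
  qed
  show ?thesis using * [of a b] * [of b a] assms by (metis linorder_neqE_nat transpose_commute)
qed

text \<open>Left multiplication by s reverses the order of only one pair of values, i and Suc i.
  Either the inequality between the images of a and b survives, or these images are i and Suc i, and
  then acting by s on values is the same as swapping the positions a and b.\<close>

lemma bruhat_step_lift:
  assumes "bruhat_step n \<sigma> \<tau>" "i \<in> {1..<n}"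
  defines "s \<equiv> Transposition.transpose i (Suc i)"
  shows "s \<circ> \<sigma> = \<tau> \<or> bruhat_step n (s \<circ> \<sigma>) (s \<circ> \<tau>)"
proof -
  obtain a b where ab: "\<sigma> permutes {1..n}" "a \<in> {1..n}" "b \<in> {1..n}" "a < b"
    "\<sigma> a < \<sigma> b" "\<tau> = \<sigma> \<circ> Transposition.transpose a b"
    using assms(1) by (elim bruhat_stepE)
  show ?thesis
  proof (cases "s (\<sigma> a) < s (\<sigma> b)")
    case True
    have "s \<circ> \<sigma> permutes {1..n}"
      using assms ab(1) unfolding s_def by (intro permutes_compose permutes_swap_id) auto
    from bruhat_step_transposeI [OF this ab(2-4)] True ab(6) show ?thesis
      by (simp add: comp_assoc)
  next
    case False
    with ab(5) have eq: "\<sigma> a = i" "\<sigma> b = Suc i"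
      by (auto simp: s_def Transposition.transpose_def split: if_splits)
    have inj: "inj \<sigma>" using ab(1) permutes_inj by blast
    have "s \<circ> \<sigma> = \<tau>"
    proof
      fix x
      have "\<sigma> x = i \<longleftrightarrow> x = a" "\<sigma> x = Suc i \<longleftrightarrow> x = b"
        using inj_eq [OF inj] eq by metis+
      then show "(s \<circ> \<sigma>) x = \<tau> x"
        using eq ab(6) by (simp add: s_def Transposition.transpose_def)
    qed
    then show ?thesis by blast
  qed
qed

text \<open>Multiply a chain of steps from \<sigma> to \<tau> by s on the left. If some step
  collapses, the chain has reached an element of the original chain and continues along it to
  \<tau>; otherwise it ends in \<open>s \<circ> \<tau>\<close>.\<close>

lemma bruhat_le_lift:
  assumes "bruhat_le n \<sigma> \<tau>" "i \<in> {1..<n}"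
  defines "s \<equiv> Transposition.transpose i (Suc i)"
  shows "bruhat_le n (s \<circ> \<sigma>) \<tau> \<or> bruhat_le n (s \<circ> \<sigma>) (s \<circ> \<tau>)"
  using assms(1) unfolding bruhat_le_def
proof (induction rule: converse_rtranclp_induct)
  case (step \<sigma> \<sigma>')
  from bruhat_step_lift [OF step(1) assms(2)] show ?case
    using step.hyps(2) step.IH unfolding s_def by (metis converse_rtranclp_into_rtranclp)
qed auto

lemma bruhat_le_refl [simp]: "bruhat_le n \<sigma> \<sigma>"
  by (simp add: bruhat_le_def)

lemma bruhat_le_trans: "bruhat_le n \<sigma> \<tau> \<Longrightarrow> bruhat_le n \<tau> \<rho> \<Longrightarrow> bruhat_le n \<sigma> \<rho>"
  by (simp add: bruhat_le_def)

lemma reduced_word_Cons: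
  assumes "reduced_word n (i # is)"
  shows "reduced_word n is"
proof -
  have *: "set is \<subseteq> {1..<n}" "i \<in> {1..<n}" using assms by (auto simp: reduced_word_def)
  then obtain js where js: "set js \<subseteq> {1..<n}" "adj_word_prod is = adj_word_prod js"
    "length js = perm_length n (adj_word_prod is)"
    using perm_length_word [OF adj_word_prod_permutes] by metis
  have "perm_length n (adj_word_prod (i # js)) \<le> length (i # js)"
    using js * by (intro perm_length_le) auto
  with js assms have "length is \<le> perm_length n (adj_word_prod is)"
    by (auto simp: reduced_word_def)
  with * perm_length_le [of "is" n] show ?thesis by (auto simp: reduced_word_def)
qed

lemma transpose_comp_eq:
  assumes "bij \<sigma>"
  shows "Transposition.transpose x y \<circ> \<sigma> = \<sigma> \<circ> Transposition.transpose (inv \<sigma> x) (inv \<sigma> y)"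
proof
  fix z
  have "inj \<sigma>" "surj \<sigma>" using assms by (auto simp: bij_def)
  then show "(Transposition.transpose x y \<circ> \<sigma>) z = (\<sigma> \<circ> Transposition.transpose (inv \<sigma> x) (inv \<sigma> y)) z"
    by (auto simp: Transposition.transpose_def inv_f_f surj_f_inv_f)
qed

text \<open>Moving the letter i past the suffix \<open>ys\<close> conjugates it into the
  transposition of the preimages of i and Suc i under that suffix. This is the reverse of strong
  exchange.\<close>

lemma adj_word_prod_delete:
  assumes "set (xs @ i # ys) \<subseteq> {1..<n}"
  obtains a b where "a \<in> {1..n}" "b \<in> {1..n}" "a \<noteq> b"
    "adj_word_prod (xs @ i # ys) = adj_word_prod (xs @ ys) \<circ> Transposition.transpose a b"
proof -
  let ?p = "adj_word_prod ys"
  have p: "?p permutes {1..n}" "bij ?p" using assms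
    by (auto intro!: adj_word_prod_permutes bij_adj_word_prod simp del: One_nat_def)
  have ip: "inv ?p permutes {1..n}" using p permutes_inv by blast
  show thesis
  proof
    show "inv ?p i \<in> {1..n}" "inv ?p (Suc i) \<in> {1..n}"
      using permutes_in_image [OF ip] assms by auto
    show "inv ?p i \<noteq> inv ?p (Suc i)" 
      using inj_eq [OF permutes_inj [OF ip]] by simp
    show "adj_word_prod (xs @ i # ys) =
      adj_word_prod (xs @ ys) \<circ> Transposition.transpose (inv ?p i) (inv ?p (Suc i))"
      unfolding adj_word_prod_append adj_word_prod_Cons transpose_comp_eq [OF p(2)] comp_assoc ..
  qed
qed

lemma reduced_word_step:
  assumes "reduced_word n (i # is)"
  shows "bruhat_step n (adj_word_prod is) (adj_word_prod (i # is))"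
proof -
  have red: "reduced_word n is" using assms by (rule reduced_word_Cons)
  have w: "set ([] @ i # is) \<subseteq> {1..<n}" using assms by (simp add: reduced_word_def)
  obtain a b where ab: "a \<in> {1..n}" "b \<in> {1..n}" "a \<noteq> b"
    "adj_word_prod ([] @ i # is) = adj_word_prod ([] @ is) \<circ> Transposition.transpose a b"
    using adj_word_prod_delete [OF w] by blast
  have "adj_word_prod is = adj_word_prod ([] @ i # is) \<circ> Transposition.transpose a b"
    unfolding ab(4) by (simp add: comp_assoc)
  then have "adj_word_prod is = adj_word_prod (i # is) \<circ> Transposition.transpose a b"
    unfolding append_Nil .
  moreover have "adj_word_prod is permutes {1..n}" "adj_word_prod (i # is) permutes {1..n}"
    using w by (intro adj_word_prod_permutes; auto)+
  moreover have "perm_length n (adj_word_prod is) < perm_length n (adj_word_prod (i # is))"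
    using assms red by (simp add: reduced_word_def)
  ultimately show ?thesis using ab(1-3) unfolding bruhat_step_def by blast
qed

text \<open>Induction on the first letter i. If the subword avoids it, the induction hypothesis is
  followed by the step that adds i; if the subword starts with it, the lifting property multiplies
  both sides by i, and the case where the upper side stays put is repaired by the same step.\<close>

lemma subword_bruhat_le:
  assumes "subseq js is" "reduced_word n is"
  shows "bruhat_le n (adj_word_prod js) (adj_word_prod is)"
  using assms
proof (induction "is" arbitrary: js rule: list.induct)
  case (Cons i "is")
  have red: "reduced_word n is" using Cons.prems(2) by (rule reduced_word_Cons)
  have i: "i \<in> {1..<n}" using Cons.prems(2) by (simp add: reduced_word_def)
  have up: "bruhat_le n (adj_word_prod is) (adj_word_prod (i # is))"
    using reduced_word_step [OF Cons.prems(2)] unfolding bruhat_le_def by blast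
  show ?case
  proof (cases "subseq js is")
    case True
    then show ?thesis by (intro bruhat_le_trans [OF Cons.IH [OF _ red] up])
  next
    case False
    obtain ks where ks: "js = i # ks" "subseq ks is"
      using Cons.prems(1) False by cases auto
    then have "bruhat_le n (adj_word_prod js) (adj_word_prod is) \<or>
        bruhat_le n (adj_word_prod js) (adj_word_prod (i # is))"
      using bruhat_le_lift [OF Cons.IH [OF ks(2) red] i] unfolding ks(1) adj_word_prod_Cons by blast
    then show ?thesis using bruhat_le_trans [OF _ up] by blast
  qed
next
  case Nil
  then have "js = []" by simp
  then show ?case by (simp only: bruhat_le_refl)
qed

section \<open>Words with and without repeated letters\<close>

text \<open>Only the letter i moves a value across the cut between i and Suc i. The set thus depends
  on the permutation alone, but constrains every word for it.\<close>

definition adj_support :: "(nat \<Rightarrow> nat) \<Rightarrow> nat set" where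
  "adj_support \<sigma> = {i. \<sigma> ` {..i} \<noteq> {..i}}"

lemma image_adj_word_prod_atMost:
  assumes "i \<notin> set is"
  shows "adj_word_prod is ` {..i} = {..i}"
  using assms
proof (induction "is" rule: list.induct)
  case Nil
  show ?case by simp
next
  case (Cons j "is")
  then have "j \<noteq> i" and IH: "adj_word_prod is ` {..i} = {..i}" by auto
  have "Transposition.transpose j (Suc j) ` {..i} = {..i}"
    using \<open>j \<noteq> i\<close> by (intro transpose_image_eq) auto
  then show ?case by (simp only: adj_word_prod_Cons image_comp [symmetric] IH)
qed

lemma adj_support_subset: "adj_support (adj_word_prod is) \<subseteq> set is"
  using image_adj_word_prod_atMost unfolding adj_support_def by blast

text \<open>A letter occurring exactly once crosses its cut exactly once, and no other letter can
  undo this: prefix and suffix both preserve \<open>{..i}\<close>.\<close>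

lemma adj_support_distinct:
  assumes "distinct is"
  shows "adj_support (adj_word_prod is) = set is"
proof
  show "set is \<subseteq> adj_support (adj_word_prod is)"
  proof
    fix i assume "i \<in> set is"
    then obtain xs ys where eq: "is = xs @ i # ys" by (meson split_list)
    with assms have notin: "i \<notin> set xs" "i \<notin> set ys" by auto
    let ?s = "Transposition.transpose i (Suc i)"
    have "adj_word_prod is ` {..i} = adj_word_prod xs ` ?s ` {..i}"
      by (simp only: eq adj_word_prod_append adj_word_prod_Cons image_comp [symmetric]
          image_adj_word_prod_atMost [OF notin(2)])
    moreover have "inj (adj_word_prod xs)" using bij_adj_word_prod by (rule bij_is_inj)
    moreover have "?s ` {..i} \<noteq> {..i}"
    proof
      assume "?s ` {..i} = {..i}"
      moreover have "?s i \<in> ?s ` {..i}" by blast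
      ultimately show False by simp
    qed
    ultimately have "adj_word_prod is ` {..i} \<noteq> {..i}"
      using image_adj_word_prod_atMost [OF notin(1)] by (metis inj_image_eq_iff)
    then show "i \<in> adj_support (adj_word_prod is)" by (simp add: adj_support_def)
  qed
qed (rule adj_support_subset)

text \<open>Every other word with the same product must contain the whole support, which is
  \<open>set is\<close>, and so has at least as many letters.\<close>

lemma reduced_word_distinct:
  assumes "distinct is" "set is \<subseteq> {1..<n}"
  shows "reduced_word n is"
proof -
  obtain js where js: "adj_word_prod is = adj_word_prod js"
    "length js = perm_length n (adj_word_prod is)"
    using perm_length_word [OF adj_word_prod_permutes [OF assms(2)]] by metis
  have "set is \<subseteq> set js"
    using adj_support_distinct [OF assms(1)] adj_support_subset [of js] js(1) by simp
  then have "length is \<le> length js"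
    using distinct_card [OF assms(1)] card_length [of js] card_mono [of "set js" "set is"] by simp
  with js(2) perm_length_le [OF assms(2)] assms(2) show ?thesis by (simp add: reduced_word_def)
qed

text \<open>The lower neighbour is expressed through \<open>Suc\<close>, since with truncated
  subtraction the letter 0 would become its own neighbour.\<close>

lemma adj_word_prod_commute:
  assumes "Suc i \<notin> set is" "\<And>j. i = Suc j \<Longrightarrow> j \<notin> set is"
  shows "Transposition.transpose i (Suc i) \<circ> adj_word_prod is =
    adj_word_prod is \<circ> Transposition.transpose i (Suc i)"
  using assms
proof (induction "is" rule: list.induct)
  case Nil
  show ?case by simp
next
  case (Cons k "is")
  let ?s = "\<lambda>i. Transposition.transpose i (Suc i)"
  have ik: "Suc i \<noteq> k" "i \<noteq> Suc k" using Cons.prems(1) Cons.prems(2) [of k] by auto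
  have "?s i \<circ> ?s k = ?s k \<circ> ?s i"
    using ik by (auto simp: fun_eq_iff Transposition.transpose_def)
  moreover have "?s i \<circ> adj_word_prod is = adj_word_prod is \<circ> ?s i"
    using Cons.prems by (intro Cons.IH) auto
  ultimately show ?case unfolding adj_word_prod_Cons by (metis comp_assoc)
qed

lemma reduced_word_not_distinct:
  assumes "reduced_word n is" "\<not> distinct is"
  obtains i j where "j = Suc i \<or> i = Suc j" "subseq [i, j, i] is"
proof -
  obtain xs ys zs i where eq: "is = xs @ [i] @ ys @ [i] @ zs"
    using assms(2) not_distinct_decomp by blast
  \<comment> \<open>The two occurrences need not be consecutive ones: further copies of i in
    \<open>ys\<close> commute with i, so only neighbours can block the cancellation.\<close>
  have "\<exists>j \<in> set ys. j = Suc i \<or> i = Suc j"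
  proof (rule ccontr)
    assume "\<not> ?thesis"
    then have "Transposition.transpose i (Suc i) \<circ> adj_word_prod ys =
        adj_word_prod ys \<circ> Transposition.transpose i (Suc i)"
      by (intro adj_word_prod_commute) auto
    then have "adj_word_prod ([i] @ ys @ [i]) = adj_word_prod ys"
      unfolding adj_word_prod_append adj_word_prod_Cons adj_word_prod_Nil
      by (metis comp_assoc comp_id transpose_comp_involutory)
    then have "adj_word_prod is = adj_word_prod (xs @ ys @ zs)"
      unfolding eq adj_word_prod_append by (metis comp_assoc)
    moreover have "perm_length n (adj_word_prod (xs @ ys @ zs)) \<le> length (xs @ ys @ zs)"
      using assms(1) unfolding reduced_word_def eq by (intro perm_length_le) auto
    ultimately show False using assms(1) unfolding reduced_word_def eq by simp
  qed
  then obtain j where j: "j \<in> set ys" "j = Suc i \<or> i = Suc j" by blast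
  have "subseq [j] ys" using j(1) by (simp add: subseq_singleton_left)
  then have "subseq ([] @ [i] @ [j] @ [i] @ []) is"
    unfolding eq by (intro list_emb_append_mono) auto
  with j(2) that show thesis by simp
qed

section \<open>Lower intervals\<close>

lemma set_mono_subseq: "subseq xs ys \<Longrightarrow> set xs \<subseteq> set ys"
  by (auto elim: list_emb_set)

text \<open>A subword of a word without repetition is determined by its set of letters; this is why
  the interval is indexed by subsets.\<close>

lemma filter_subseq_distinct:
  assumes "subseq js is" "distinct is"
  shows "filter (\<lambda>i. i \<in> set js) is = js"
  using assms
proof (induction rule: list_emb.induct)
  case (list_emb_Nil ys)
  then show ?case by simp
next
  case (list_emb_Cons xs ys y)
  have "y \<notin> set xs" using list_emb_Cons.prems list_emb_Cons.hyps(1)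
    using set_mono_subseq by fastforce
  with list_emb_Cons show ?case by simp
next
  case (list_emb_Cons2 x y xs ys)
  then have "filter (\<lambda>i. i \<in> set (x # xs)) ys = filter (\<lambda>i. i \<in> set xs) ys"
    by (intro filter_cong) auto
  with list_emb_Cons2 show ?case by simp
qed

lemma bruhat_step_subword:
  assumes "bruhat_step n \<tau> (adj_word_prod is)"
  obtains xs i ys where "is = xs @ i # ys" "\<tau> = adj_word_prod (xs @ ys)"
proof -
  obtain a b where "a < b" "\<tau> = adj_word_prod is \<circ> Transposition.transpose a b"
    "adj_word_prod is b < adj_word_prod is a"
    using assms by (elim bruhat_stepE)
  with strong_exchange that show thesis by metis
qed

text \<open>Descending along a chain, strong exchange deletes one letter at each step. It applies
  again to the word that is left, whether or not that word is reduced.\<close>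

lemma bruhat_le_subword:
  assumes "bruhat_le n \<tau> (adj_word_prod is)"
  obtains js where "subseq js is" "\<tau> = adj_word_prod js"
proof -
  have "\<exists>js. subseq js is \<and> \<tau> = adj_word_prod js"
    using assms unfolding bruhat_le_def
  proof (induction rule: converse_rtranclp_induct)
    case base
    then show ?case by blast
  next
    case (step \<tau> \<rho>)
    then obtain js where js: "subseq js is" "\<rho> = adj_word_prod js" by blast
    with step(1) obtain xs i ys where "js = xs @ i # ys" "\<tau> = adj_word_prod (xs @ ys)"
      by (metis bruhat_step_subword)
    moreover have "subseq (xs @ ys) (xs @ i # ys)" by (intro list_emb_append_mono) auto
    ultimately show ?case using js(1) subseq_order.trans by blast
  qed
  with that show thesis by blast
qed

definition subword_prod :: "nat list \<Rightarrow> nat set \<Rightarrow> nat \<Rightarrow> nat" where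
  "subword_prod is S = adj_word_prod (filter (\<lambda>i. i \<in> S) is)"

lemma adj_support_subword_prod:
  assumes "distinct is"
  shows "adj_support (subword_prod is S) = S \<inter> set is"
  using assms by (auto simp: subword_prod_def adj_support_distinct)

lemma bruhat_interval_distinct:
  assumes "distinct is" "set is \<subseteq> {1..<n}"
  shows "{\<tau>. \<tau> permutes {1..n} \<and> bruhat_le n \<tau> (adj_word_prod is)} = subword_prod is ` Pow (set is)"
proof (intro equalityI subsetI)
  fix \<tau> assume "\<tau> \<in> {\<tau>. \<tau> permutes {1..n} \<and> bruhat_le n \<tau> (adj_word_prod is)}"
  then obtain js where js: "subseq js is" "\<tau> = adj_word_prod js" by (auto elim: bruhat_le_subword)
  then have "\<tau> = subword_prod is (set js)"
    using filter_subseq_distinct [OF js(1) assms(1)] by (simp add: subword_prod_def)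
  moreover have "set js \<subseteq> set is" using js(1) by (rule set_mono_subseq)
  ultimately show "\<tau> \<in> subword_prod is ` Pow (set is)" by blast
next
  fix \<tau> assume "\<tau> \<in> subword_prod is ` Pow (set is)"
  then obtain S where S: "\<tau> = adj_word_prod (filter (\<lambda>i. i \<in> S) is)"
    by (auto simp: subword_prod_def)
  have "bruhat_le n \<tau> (adj_word_prod is)"
    unfolding S by (intro subword_bruhat_le reduced_word_distinct assms) simp
  moreover have "\<tau> permutes {1..n}"
    unfolding S using assms(2) by (intro adj_word_prod_permutes) auto
  ultimately show "\<tau> \<in> {\<tau>. \<tau> permutes {1..n} \<and> bruhat_le n \<tau> (adj_word_prod is)}" by simp
qed

text \<open>A step down deletes one letter, and comparing supports shows which; so no edge skips a
  level. Conversely, inserting a letter multiplies by a transposition, and the lengths are known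
  because both words are reduced.\<close>

lemma bruhat_step_subword_prod:
  assumes "distinct is" "set is \<subseteq> {1..<n}" "S \<subseteq> set is" "T \<subseteq> set is"
  shows "bruhat_step n (subword_prod is S) (subword_prod is T) \<longleftrightarrow> (\<exists>i. i \<notin> S \<and> T = insert i S)"
proof
  let ?js = "filter (\<lambda>i. i \<in> T) is"
  assume "bruhat_step n (subword_prod is S) (subword_prod is T)"
  then obtain xs i ys where eq: "?js = xs @ i # ys" "subword_prod is S = adj_word_prod (xs @ ys)"
    unfolding subword_prod_def [of _ T] by (elim bruhat_step_subword)
  have "distinct ?js" using assms(1) by simp
  then have d: "distinct (xs @ ys)" "i \<notin> set (xs @ ys)" unfolding eq(1) by auto
  have "S = set (xs @ ys)"
    using adj_support_subword_prod [OF assms(1), of S] adj_support_distinct [OF d(1)] assms(3) eq(2)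
    by auto
  moreover have "T = set (xs @ i # ys)" unfolding eq(1) [symmetric] using assms(4) by auto
  ultimately have "i \<notin> S \<and> T = insert i S" using d(2) by auto
  then show "\<exists>i. i \<notin> S \<and> T = insert i S" by blast
next
  assume "\<exists>i. i \<notin> S \<and> T = insert i S"
  then obtain i where i: "i \<notin> S" "T = insert i S" by blast
  with assms(4) obtain xs ys where eq: "is = xs @ i # ys" by (auto dest: split_list)
  have ni: "i \<notin> set xs" "i \<notin> set ys" using assms(1) unfolding eq by auto
  let ?f = "\<lambda>zs. filter (\<lambda>i. i \<in> S) zs"
  have "filter (\<lambda>j. j \<in> T) zs = ?f zs" if "i \<notin> set zs" for zs
    unfolding i(2) using that by (intro filter_cong) auto
  then have T: "filter (\<lambda>i. i \<in> T) is = ?f xs @ i # ?f ys"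
    unfolding eq using ni i(2) by simp
  have S: "filter (\<lambda>i. i \<in> S) is = ?f xs @ ?f ys" unfolding eq using i(1) by simp
  have sub: "set (?f xs @ i # ?f ys) \<subseteq> {1..<n}" "set (?f xs @ ?f ys) \<subseteq> {1..<n}"
    using assms(2) unfolding eq by auto
  have dist: "distinct (?f xs @ i # ?f ys)" "distinct (?f xs @ ?f ys)"
    using assms(1) unfolding eq by auto
  obtain a b where ab: "a \<in> {1..n}" "b \<in> {1..n}" "a \<noteq> b"
    "adj_word_prod (?f xs @ i # ?f ys) = adj_word_prod (?f xs @ ?f ys) \<circ> Transposition.transpose a b"
    using adj_word_prod_delete [OF sub(1)] by blast
  have "adj_word_prod (?f xs @ ?f ys) = adj_word_prod (?f xs @ i # ?f ys) \<circ> Transposition.transpose a b"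
    unfolding ab(4) by (simp only: comp_assoc transpose_comp_involutory comp_id)
  moreover have "perm_length n (adj_word_prod (?f xs @ ?f ys)) <
      perm_length n (adj_word_prod (?f xs @ i # ?f ys))"
    using reduced_word_distinct [OF dist(1) sub(1)] reduced_word_distinct [OF dist(2) sub(2)]
    unfolding reduced_word_def by simp
  ultimately show "bruhat_step n (subword_prod is S) (subword_prod is T)"
    unfolding subword_prod_def S T bruhat_step_def
    using adj_word_prod_permutes [OF sub(1)] adj_word_prod_permutes [OF sub(2)] ab(1-3) by blast
qed

lemma verts_lower_bruhat_graph [simp]:
  "verts (lower_bruhat_graph n \<sigma>) = {\<tau>. \<tau> permutes {1..n} \<and> bruhat_le n \<tau> \<sigma>}"
  by (simp add: lower_bruhat_graph_def)

lemma arc_mk_symmetric_lower_bruhat_graph: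
  "(\<tau>, \<rho>) \<in> parcs (mk_symmetric (lower_bruhat_graph n \<sigma>)) \<longleftrightarrow>
     bruhat_le n \<tau> \<sigma> \<and> bruhat_le n \<rho> \<sigma> \<and> (bruhat_step n \<tau> \<rho> \<or> bruhat_step n \<rho> \<tau>)"
proof -
  have "\<tau> permutes {1..n} \<and> \<rho> permutes {1..n}" if "bruhat_step n \<tau> \<rho> \<or> bruhat_step n \<rho> \<tau>"
    using that by (auto simp: bruhat_step_def)
  then show ?thesis
    by (auto simp: mk_symmetric_def lower_bruhat_graph_def bruhat_graph_def)
qed

lemma pverts_mk_symmetric [simp]: "pverts (mk_symmetric G) = verts G"
  by (simp add: mk_symmetric_def)

text \<open>The \<open>a\<close>'s are the even and the \<open>b\<close>'s the odd elements of the copy of \<open>S\<^sub>3\<close> that the letters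
  \<open>i\<close> and \<open>j\<close> generate.\<close>

lemma lower_bruhat_graph_K33:
  assumes red: "reduced_word n is" and sub: "subseq [i, j, i] is" and ij: "j = Suc i \<or> i = Suc j"
  shows "\<exists>a0 a1 a2 b0 b1 b2. distinct [a0, a1, a2, b0, b1, b2] \<and>
    (\<forall>a\<in>{a0, a1, a2}. \<forall>b\<in>{b0, b1, b2}.
      (a, b) \<in> parcs (mk_symmetric (lower_bruhat_graph n (adj_word_prod is))))"
proof -
  define m where "m = min i j"
  let ?P = adj_word_prod
  let ?E = "parcs (mk_symmetric (lower_bruhat_graph n (?P is)))"
  let ?W = "{[], [m], [Suc m], [m, Suc m], [Suc m, m], [m, Suc m, m]}"
  have m: "i = m \<and> j = Suc m \<or> i = Suc m \<and> j = m" using ij by (auto simp: m_def)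
  have "set [i, j, i] \<subseteq> {1..<n}"
    using set_mono_subseq [OF sub] red unfolding reduced_word_def by blast
  then have mn: "1 \<le> m" "Suc m < n" using m by auto
  \<comment> \<open>If i is the larger of the two letters, the longest element appears as the other
    braid word; the relation lets one list of six words serve both cases.\<close>
  have braid: "?P [Suc m, m, Suc m] = ?P [m, Suc m, m]"
    by (auto simp: fun_eq_iff Transposition.transpose_def)
  have le_sub: "bruhat_le n (?P w) (?P is)" if "subseq w [i, j, i]" for w
    using subword_bruhat_le [OF subseq_order.trans [OF that sub] red] .
  have le: "bruhat_le n (?P w) (?P is)" if "w \<in> ?W" for w
  proof (cases "i = m")
    case True
    then have "j = Suc m" using m by auto
    with True that show ?thesis by (intro le_sub) auto
  next
    case False
    then have ij': "i = Suc m" "j = m" using m by auto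
    show ?thesis
    proof (cases "w = [m, Suc m, m]")
      case True
      have "bruhat_le n (?P [Suc m, m, Suc m]) (?P is)" using ij' by (intro le_sub) auto
      then show ?thesis unfolding True braid .
    next
      case False
      with that ij' show ?thesis by (intro le_sub) auto
    qed
  qed
  have perm: "?P w permutes {1..n}" if "w \<in> ?W" for w
    using that mn by (intro adj_word_prod_permutes) auto
  have arc: "(?P v, ?P w) \<in> ?E"
    if "v \<in> ?W" "w \<in> ?W" "?P w = ?P v \<circ> Transposition.transpose x y"
      "x \<in> {m, Suc m, Suc (Suc m)}" "y \<in> {m, Suc m, Suc (Suc m)}" "x \<noteq> y" for v w x y
  proof -
    have "x \<in> {1..n}" "y \<in> {1..n}" using that(4,5) mn by auto
    from bruhat_step_transpose_cases [OF perm [OF that(1)] this that(6)] le [OF that(1)] le [OF that(2)]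
    show ?thesis unfolding arc_mk_symmetric_lower_bruhat_graph that(3) by blast
  qed
  \<comment> \<open>The six products permute m, m + 1, m + 2, so their values at the first two of
    these points already tell them apart.\<close>
  have "distinct (map (\<lambda>w. (?P w m, ?P w (Suc m)))
      [[], [m, Suc m], [Suc m, m], [m], [Suc m], [m, Suc m, m]])"
    by (simp add: Transposition.transpose_def)
  then have "distinct (map (\<lambda>\<pi>. (\<pi> m, \<pi> (Suc m)))
      (map ?P [[], [m, Suc m], [Suc m, m], [m], [Suc m], [m, Suc m, m]]))"
    by (simp only: map_map comp_def)
  then have "distinct (map ?P [[], [m, Suc m], [Suc m, m], [m], [Suc m], [m, Suc m, m]])"
    by (simp only: distinct_map)
  moreover
  let ?t = "\<lambda>x y. Transposition.transpose (x::nat) y" and ?k = "Suc (Suc m)"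
  have eqs: "?P [m] = ?P [] \<circ> ?t m (Suc m)" "?P [Suc m] = ?P [] \<circ> ?t (Suc m) ?k"
    "?P [m, Suc m, m] = ?P [] \<circ> ?t m ?k"
    "?P [m] = ?P [m, Suc m] \<circ> ?t (Suc m) ?k" "?P [Suc m] = ?P [m, Suc m] \<circ> ?t m ?k"
    "?P [m, Suc m, m] = ?P [m, Suc m] \<circ> ?t m (Suc m)"
    "?P [m] = ?P [Suc m, m] \<circ> ?t m ?k" "?P [Suc m] = ?P [Suc m, m] \<circ> ?t m (Suc m)"
    "?P [m, Suc m, m] = ?P [Suc m, m] \<circ> ?t (Suc m) ?k"
    by (auto simp: fun_eq_iff Transposition.transpose_def)
  have "\<forall>a\<in>{?P [], ?P [m, Suc m], ?P [Suc m, m]}. \<forall>b\<in>{?P [m], ?P [Suc m], ?P [m, Suc m, m]}.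
      (a, b) \<in> ?E"
    unfolding ball_simps
    by (intro conjI TrueI; (rule arc, (simp; fail), (simp; fail), (rule eqs; fail), (simp; fail)+))
  ultimately show ?thesis unfolding list.map by blast
qed

section \<open>Arcs in the plane\<close>

text \<open>Forgets the parametrisation, so that arcs can be reversed, joined and intersected as
  plain sets with marked ends.\<close>

definition arc_between :: "complex \<Rightarrow> complex \<Rightarrow> complex set \<Rightarrow> bool" where
  "arc_between x y S \<longleftrightarrow> (\<exists>g. arc g \<and> pathstart g = x \<and> pathfinish g = y \<and> path_image g = S)"

lemma arc_between_commute: "arc_between x y S \<longleftrightarrow> arc_between y x S"
proof -
  have "arc_between y x S" if "arc_between x y S" for x y
    using that unfolding arc_between_def
    by (metis arc_reversepath path_image_reversepath pathfinish_reversepath pathstart_reversepath)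
  then show ?thesis by blast
qed

lemma arc_between_ends:
  assumes "arc_between x y S"
  shows "x \<in> S" "y \<in> S" "x \<noteq> y"
  using assms unfolding arc_between_def
  by (auto dest: arc_distinct_ends)

lemma arc_between_join:
  assumes "arc_between x y S" "arc_between y z T" "S \<inter> T \<subseteq> {y}"
  shows "arc_between x z (S \<union> T)"
proof -
  obtain g h where "arc g" "pathstart g = x" "pathfinish g = y" "path_image g = S"
    "arc h" "pathstart h = y" "pathfinish h = z" "path_image h = T"
    using assms(1,2) by (auto simp: arc_between_def)
  with assms(3) show ?thesis
    unfolding arc_between_def
    by (intro exI [of _ "g +++ h"]) (auto simp: arc_join path_image_join)
qed

lemma arc_between_image:
  assumes "arc_between x y S" "continuous_on S f" "inj_on f S"
  shows "arc_between (f x) (f y) (f ` S)"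
proof -
  obtain g where g: "arc g" "pathstart g = x" "pathfinish g = y" "path_image g = S"
    using assms(1) by (auto simp: arc_between_def)
  have "arc (f \<circ> g)"
    unfolding arc_def
  proof
    show "path (f \<circ> g)" using g assms(2) by (intro path_continuous_image) (auto simp: arc_imp_path)
    show "inj_on (f \<circ> g) {0..1}"
      using g assms(3) by (intro comp_inj_on) (auto simp: arc_def path_image_def)
  qed
  with g show ?thesis unfolding arc_between_def
    by (intro exI [of _ "f \<circ> g"]) (auto simp: pathstart_compose pathfinish_compose path_image_compose)
qed

text \<open>An open arc that avoids a curve stays on one side of it by connectedness, and its ends
  then lie in the closure of that side.\<close>

lemma arc_between_endless:
  assumes "arc_between x y S"
  shows "topological_space_class.connected (S - {x, y})" "S \<subseteq> closure (S - {x, y})"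
proof -
  obtain g where g: "arc g" "pathstart g = x" "pathfinish g = y" "path_image g = S"
    using assms by (auto simp: arc_between_def)
  show "topological_space_class.connected (S - {x, y})"
    using connected_simple_path_endless [OF arc_imp_simple_path [OF g(1)]] g(2-4) by simp
  have "g ` closure {0<..<1} \<subseteq> closure (g ` {0<..<1})"
    using arc_imp_path [OF g(1)]
    by (intro image_closure_subset) (auto simp: path_def intro: closure_subset [THEN subsetD])
  moreover have "g ` {0<..<1} = S - {x, y}"
    using simple_path_endless [OF arc_imp_simple_path [OF g(1)]] g(2-4) by simp
  ultimately show "S \<subseteq> closure (S - {x, y})" using g(4) by (simp add: path_image_def)
qed

lemma arc_between_loop:
  assumes "arc_between x y S" "arc_between x y T" "S \<inter> T \<subseteq> {x, y}"
  obtains c where "simple_path c" "pathfinish c = pathstart c" "path_image c = S \<union> T"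
proof -
  obtain g h where gh: "arc g" "pathstart g = x" "pathfinish g = y" "path_image g = S"
    "arc h" "pathstart h = y" "pathfinish h = x" "path_image h = T"
    using assms(1,2) unfolding arc_between_commute [of x y T] by (auto simp: arc_between_def)
  show thesis
  proof
    show "simple_path (g +++ h)" using gh assms(3) by (intro simple_path_join_loop) auto
    show "pathfinish (g +++ h) = pathstart (g +++ h)" using gh by simp
    show "path_image (g +++ h) = S \<union> T" using gh by (simp add: path_image_join)
  qed
qed

text \<open>The chord C cuts the inside of \<open>P \<union> Q\<close> into A, bounded by
  \<open>P \<union> C\<close>, and B, bounded by \<open>Q \<union> C\<close>. The open arc of D
  avoids all three curves, hence lies in A or in B. In A, its end x4 would lie in the closure of A,
  although x4 is on Q and on neither P nor C; in B, the end x2 on P gives the same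
  contradiction.\<close>

lemma crossing_chords_inside:
  assumes P: "arc_between x1 x3 P" and Q: "arc_between x1 x3 Q" and C: "arc_between x1 x3 C"
    and D: "arc_between x2 x4 D"
    and PQ: "P \<inter> Q \<subseteq> {x1, x3}" and PC: "P \<inter> C \<subseteq> {x1, x3}" and QC: "Q \<inter> C \<subseteq> {x1, x3}"
    and CD: "C \<inter> D = {}" and PD: "P \<inter> D = {x2}" and QD: "Q \<inter> D = {x4}"
    and Cin: "C \<inter> inside (P \<union> Q) \<noteq> {}"
    and Din: "D \<inter> inside (P \<union> Q) \<noteq> {}"
  shows False
proof -
  obtain p q c where p: "arc p" "pathstart p = x1" "pathfinish p = x3" "path_image p = P"
    and q: "arc q" "pathstart q = x1" "pathfinish q = x3" "path_image q = Q"
    and c: "arc c" "pathstart c = x1" "pathfinish c = x3" "path_image c = C"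
    using P Q C by (auto simp: arc_between_def)
  have ends: "x1 \<in> P" "x3 \<in> P" "x1 \<in> Q" "x3 \<in> Q" "x1 \<in> C" "x3 \<in> C" "x1 \<noteq> x3"
    using arc_between_ends P Q C by blast+
  have eqs: "path_image p \<inter> path_image q = {x1, x3}" "path_image p \<inter> path_image c = {x1, x3}"
    "path_image q \<inter> path_image c = {x1, x3}"
    using PQ PC QC ends p(4) q(4) c(4) by auto
  have Cin': "path_image c \<inter> inside (path_image p \<union> path_image q) \<noteq> {}"
    using Cin p(4) q(4) c(4) by simp
  define A where "A = inside (P \<union> C)"
  define B where "B = inside (Q \<union> C)"
  have AB: "A \<inter> B = {}" "A \<union> B \<union> (C - {x1, x3}) = inside (P \<union> Q)"
    using split_inside_simple_closed_curve
      [OF arc_imp_simple_path [OF p(1)] p(2,3) arc_imp_simple_path [OF q(1)] q(2,3)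
          arc_imp_simple_path [OF c(1)] c(2,3) ends(7) eqs Cin']
    unfolding p(4) q(4) c(4) A_def B_def by blast+
  obtain u where u: "simple_path u" "pathfinish u = pathstart u" "path_image u = P \<union> C"
    using arc_between_loop [OF P C PC] .
  obtain v where v: "simple_path v" "pathfinish v = pathstart v" "path_image v = Q \<union> C"
    using arc_between_loop [OF Q C QC] .
  have A: "open A" "frontier A = P \<union> C" using Jordan_inside_outside [OF u(1,2)] unfolding A_def u(3) by auto
  have B: "open B" "frontier B = Q \<union> C" using Jordan_inside_outside [OF v(1,2)] unfolding B_def v(3) by auto
  define D' where "D' = D - {x2, x4}"
  have conD: "topological_space_class.connected D'" and clD: "D \<subseteq> closure D'"
    using arc_between_endless [OF D] unfolding D'_def by auto
  have disj: "(P \<union> Q) \<inter> D' = {}" using PD QD unfolding D'_def by blast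
  have inPQ: "inside (P \<union> Q) \<inter> (P \<union> Q) = {}" using inside_no_overlap by blast
  have D'in: "D' \<inter> inside (P \<union> Q) \<noteq> {}" using Din PD QD inPQ unfolding D'_def by blast
  \<comment> \<open>D' is connected and avoids the closed curve, so one point inside forces all of
    it inside.\<close>
  have sub: "D' \<subseteq> inside (P \<union> Q)"
  proof
    fix z assume "z \<in> D'"
    obtain w where w: "w \<in> D'" "w \<in> inside (P \<union> Q)" using D'in by blast
    have "connected_component (- (P \<union> Q)) w z"
      unfolding connected_component_def using conD disj w(1) \<open>z \<in> D'\<close> by blast
    then show "z \<in> inside (P \<union> Q)" using w(2) inside_same_component by blast
  qed
  have "D' \<subseteq> A \<union> B" using sub AB(2) CD unfolding D'_def by blast
  then have "A \<inter> D' = {} \<or> B \<inter> D' = {}"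
    using connectedD [OF conD A(1) B(1)] AB(1) by blast
  then have "D' \<subseteq> A \<or> D' \<subseteq> B" using \<open>D' \<subseteq> A \<union> B\<close> by blast
  then show False
  proof
    assume "D' \<subseteq> A"
    then have "x4 \<in> closure A" using clD closure_mono [of D' A] QD by blast
    then have "x4 \<in> A \<union> (P \<union> C)" using A(2) by (simp add: closure_Un_frontier)
    moreover have "x4 \<notin> P" using PQ PD QD CD ends by blast
    moreover have "x4 \<notin> C" using CD QD by blast
    ultimately have "x4 \<in> inside (P \<union> Q)" using AB(2) by blast
    then show False using QD inPQ by blast
  next
    assume "D' \<subseteq> B"
    then have "x2 \<in> closure B" using clD closure_mono [of D' B] PD by blast
    then have "x2 \<in> B \<union> (Q \<union> C)" using B(2) by (simp add: closure_Un_frontier)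
    moreover have "x2 \<notin> Q" using PQ PD QD CD ends by blast
    moreover have "x2 \<notin> C" using CD PD by blast
    ultimately have "x2 \<in> inside (P \<union> Q)" using AB(2) by blast
    then show False using PD inPQ by blast
  qed
qed

text \<open>The punctured inside is connected and its image is unbounded near z0, so it goes to the
  outside of the image curve. If the old outside went there too, so would 0, the limit at infinity,
  and nothing would be left for the inside of the image curve, which is nonempty.\<close>

lemma inversion_outside_subset_inside:
  fixes c :: "real \<Rightarrow> complex"
  assumes c: "simple_path c" "pathfinish c = pathstart c" and z0: "z0 \<in> inside (path_image c)"
  shows "(\<lambda>z. inverse (z - z0)) ` outside (path_image c) \<subseteq> inside ((\<lambda>z. inverse (z - z0)) ` path_image c)"
proof -
  define J where "J = path_image c"
  define f where "f = (\<lambda>z::complex. inverse (z - z0))"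
  have J: "open (inside J)" "topological_space_class.connected (inside J)" "open (outside J)" "topological_space_class.connected (outside J)"
    "\<not> bounded (outside J)" "inside J \<inter> outside J = {}" "inside J \<union> outside J = - J"
    using Jordan_inside_outside [OF c] unfolding J_def by auto
  have z0J: "z0 \<in> inside J" using z0 unfolding J_def .
  then have nz0: "z0 \<notin> J" "z0 \<notin> outside J" using J(6,7) by blast+
  \<comment> \<open>By the convention \<open>inverse 0 = 0\<close>, f maps z0 to 0 and is injective
    on the whole plane.\<close>
  have inj: "inj f" by (auto simp: inj_def f_def)
  have cont: "continuous_on S f" if "z0 \<notin> S" for S
    using that unfolding f_def by (intro continuous_intros) auto
  have simple: "simple_path (f \<circ> c)"
    using nz0(1) inj unfolding J_def
    by (intro simple_path_continuous_image c cont) (auto intro: inj_on_subset)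
  have loop: "pathfinish (f \<circ> c) = pathstart (f \<circ> c)"
    using c(2) by (simp add: pathstart_compose pathfinish_compose)
  have im: "path_image (f \<circ> c) = f ` J" by (simp add: path_image_compose J_def)
  have K: "inside (f ` J) \<noteq> {}" "open (inside (f ` J))" "inside (f ` J) \<union> outside (f ` J) = - f ` J"
    "inside (f ` J) \<inter> outside (f ` J) = {}" "frontier (outside (f ` J)) = f ` J"
    "bounded (inside (f ` J))" "open (outside (f ` J))"
    using Jordan_inside_outside [OF simple loop] unfolding im by auto
  have side: "f ` T \<subseteq> inside (f ` J) \<or> f ` T \<subseteq> outside (f ` J)"
    if "topological_space_class.connected T" "T \<inter> J = {}" "z0 \<notin> T" for T
  proof -
    have "topological_space_class.connected (f ` T)" using that by (intro connected_continuous_image cont)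
    moreover have "f ` T \<subseteq> inside (f ` J) \<union> outside (f ` J)"
      using that(2) inj K(3) by (auto dest: injD)
    ultimately show ?thesis using connectedD [of "f ` T" "inside (f ` J)" "outside (f ` J)"] K by blast
  qed
  have in_side: "f ` (inside J - {z0}) \<subseteq> outside (f ` J)"
  proof -
    have "topological_space_class.connected (inside J - {z0})" using J by (intro connected_open_delete) auto
    moreover have "\<not> f ` (inside J - {z0}) \<subseteq> inside (f ` J)"
    proof
      assume "f ` (inside J - {z0}) \<subseteq> inside (f ` J)"
      then have "bounded (f ` (inside J - {z0}))" using K(6) bounded_subset by blast
      then obtain M where M: "M > 0" "\<And>z. z \<in> inside J - {z0} \<Longrightarrow> norm (f z) \<le> M"
        by (auto simp: bounded_pos)
      obtain e where e: "e > 0" "ball z0 e \<subseteq> inside J" using J(1) z0J open_contains_ball by blast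
      \<comment> \<open>Half of e keeps the point in the ball; the second bound makes the image of
        \<open>z0 + r\<close> have norm 1 / r, at least 2 M.\<close>
      define r where "r = min (e / 2) (1 / (2 * M))"
      have r: "r > 0" "r < e" "r * M < 1" using e M by (auto simp: r_def min_def field_simps)
      have "z0 + of_real r \<in> inside J - {z0}" using e r by (auto simp: subset_iff dist_norm)
      from M(2) [OF this] have "inverse r \<le> M" using r by (simp add: f_def norm_inverse)
      with r show False by (simp add: field_simps)
    qed
    ultimately show ?thesis using side [of "inside J - {z0}"] J(7) by blast
  qed
  have "f ` outside J \<subseteq> inside (f ` J)"
  proof (rule ccontr)
    assume "\<not> ?thesis"
    then have out: "f ` outside J \<subseteq> outside (f ` J)" using side [OF J(4)] J(7) nz0(2) by blast
    \<comment> \<open>0 plays the part of the point at infinity: f tends to 0 along the unbounded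
      outside.\<close>
    have "0 \<in> closure (f ` outside J)"
      unfolding closure_approachable
    proof (intro allI impI)
      fix e :: real assume "e > 0"
      obtain z where z: "z \<in> outside J" "norm z > norm z0 + 1 / e"
        using J(5) unfolding bounded_iff by (meson not_le)
      have "norm (z - z0) > 1 / e" using z(2) norm_triangle_ineq2 [of z z0] by linarith
      then have "inverse (norm (z - z0)) < inverse (1 / e)"
        using \<open>e > 0\<close> by (intro less_imp_inverse_less) auto
      then have "norm (f z) < e" by (simp add: f_def norm_inverse)
      then show "\<exists>y\<in>f ` outside J. dist y 0 < e" using z(1) by auto
    qed
    then have "0 \<in> closure (outside (f ` J))" using out closure_mono by blast
    moreover have "0 \<notin> f ` J" using nz0(1) by (auto simp: f_def)
    ultimately have zero: "0 \<in> outside (f ` J)" using K(5) by (auto simp: closure_Un_frontier)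
    have "w \<in> f ` J \<union> outside (f ` J)" for w
    proof (cases "w = 0")
      case False
      then have w: "w = f (z0 + inverse w)" "z0 + inverse w \<noteq> z0" by (auto simp: f_def)
      then show ?thesis using J(7) in_side out by blast
    qed (use zero in blast)
    then show False using K(1,3,4) by blast
  qed
  then show ?thesis unfolding f_def J_def .
qed

text \<open>Two chords meeting the inside contradict the previous case directly. Two chords that
  miss it are carried by an inversion centred inside the curve to chords that meet the inside of the
  image curve.\<close>

lemma crossing_chords_opposite_sides:
  assumes P: "arc_between x1 x3 P" and Q: "arc_between x1 x3 Q" and C: "arc_between x1 x3 C"
    and D: "arc_between x2 x4 D"
    and PQ: "P \<inter> Q \<subseteq> {x1, x3}" and PC: "P \<inter> C \<subseteq> {x1, x3}" and QC: "Q \<inter> C \<subseteq> {x1, x3}"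
    and CD: "C \<inter> D = {}" and PD: "P \<inter> D = {x2}" and QD: "Q \<inter> D = {x4}"
  shows "C \<inter> inside (P \<union> Q) \<noteq> {} \<longleftrightarrow> D \<inter> inside (P \<union> Q) = {}"
proof (rule ccontr)
  assume *: "\<not> ?thesis"
  obtain c where c: "simple_path c" "pathfinish c = pathstart c" "path_image c = P \<union> Q"
    using arc_between_loop [OF P Q PQ] .
  from * crossing_chords_inside [OF assms]
  have Cout: "C \<inter> inside (P \<union> Q) = {}" and Dout: "D \<inter> inside (P \<union> Q) = {}" by blast+
  obtain z0 where z0: "z0 \<in> inside (P \<union> Q)" using Jordan_inside_outside [OF c(1,2)] c(3) by auto
  define f where "f = (\<lambda>z. inverse (z - z0))"
  have sub: "f ` outside (P \<union> Q) \<subseteq> inside (f ` (P \<union> Q))"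
    using inversion_outside_subset_inside [OF c(1,2)] z0 unfolding c(3) f_def by blast
  have inj: "inj f" by (auto simp: inj_def f_def)
  have z0n: "z0 \<notin> P" "z0 \<notin> Q" "z0 \<notin> C" "z0 \<notin> D"
    using z0 Cout Dout inside_no_overlap [of "P \<union> Q"] by blast+
  have img: "arc_between (f x) (f y) (f ` S)" if "arc_between x y S" "z0 \<notin> S" for x y S
    using that inj unfolding f_def
    by (intro arc_between_image continuous_intros) (auto intro: inj_on_subset)
  \<comment> \<open>An arc is connected, hence more than its two ends; any further point is off the
    curve and not inside.\<close>
  have outside: "T \<inter> outside (P \<union> Q) \<noteq> {}"
    if "arc_between u v T" "T \<inter> inside (P \<union> Q) = {}" "T \<inter> (P \<union> Q) \<subseteq> {u, v}" for u v T
  proof -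
    note T = that
    have "T \<noteq> {u, v}"
    proof
      assume "T = {u, v}"
      moreover have "topological_space_class.connected T" using that(1) unfolding arc_between_def
        by (metis arc_imp_path connected_path_image)
      ultimately show False using arc_between_ends(3) [OF that(1)]
        by (metis connected_finite_iff_sing finite.emptyI finite_insert insert_not_empty
            doubleton_eq_iff insert_absorb2)
    qed
    then obtain z where "z \<in> T" "z \<notin> {u, v}" using arc_between_ends [OF T(1)] by blast
    then show ?thesis using T(2,3) inside_Un_outside [of "P \<union> Q"] by blast
  qed
  have "f ` C \<inter> inside (f ` P \<union> f ` Q) \<noteq> {}"
    using outside [OF C Cout] PC QC sub unfolding image_Un by blast
  moreover have "f ` D \<inter> inside (f ` P \<union> f ` Q) \<noteq> {}"
    using outside [OF D Dout] PD QD sub unfolding image_Un by blast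
  moreover have int: "f ` S \<inter> f ` T = f ` (S \<inter> T)" for S T
    using inj by (simp add: image_Int)
  ultimately show False
    using PQ PC QC CD PD QD
    by (intro crossing_chords_inside [OF img [OF P z0n(1)] img [OF Q z0n(2)] img [OF C z0n(3)]
          img [OF D z0n(4)]]) (auto simp: int)
qed

text \<open>J is the hexagon a_i b_i a_j b_j a_k b_k. The diagonal from a_i to b_j divides it into
  the two halves P and Q, and the diagonal from a_j to b_k joins a vertex of P to one of Q.\<close>

lemma K33_chords:
  fixes a b :: "nat \<Rightarrow> complex"
  assumes arcs: "\<And>i j. i < 3 \<Longrightarrow> j < 3 \<Longrightarrow> arc_between (a i) (b j) (S i j)"
    and disj: "\<And>i j k l. i < 3 \<Longrightarrow> j < 3 \<Longrightarrow> k < 3 \<Longrightarrow> l < 3 \<Longrightarrow> (i, j) \<noteq> (k, l) \<Longrightarrow>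
      S i j \<inter> S k l \<subseteq> {a i, b j} \<inter> {a k, b l}"
    and inj: "inj_on a {..<3}" "inj_on b {..<3}" "a ` {..<3} \<inter> b ` {..<3} = {}"
    and lt: "i < 3" "j < 3" "k < 3" and ne: "i \<noteq> j" "j \<noteq> k" "i \<noteq> k"
  defines "J \<equiv> (S i i \<union> S j i \<union> S j j) \<union> (S i k \<union> S k k \<union> S k j)"
  shows "S i j \<inter> inside J \<noteq> {} \<longleftrightarrow> S j k \<inter> inside J = {}"
proof -
  have a: "a p \<noteq> a q" and b: "b p \<noteq> b q" if "p < 3" "q < 3" "p \<noteq> q" for p q
    using inj(1,2) that by (auto dest: inj_onD)
  have ab: "a p \<noteq> b q" if "p < 3" "q < 3" for p q using inj(3) that by blast
  have row: "S p q \<inter> S p s \<subseteq> {a p}" if "p < 3" "q < 3" "s < 3" "q \<noteq> s" for p q s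
    using disj [of p q p s] that b [of q s] ab [of p q] ab [of p s] by auto
  have col: "S p q \<inter> S r q \<subseteq> {b q}" if "p < 3" "q < 3" "r < 3" "p \<noteq> r" for p q r
    using disj [of p q r q] that a [of p r] ab [of p q] ab [of r q] by auto
  have off: "S p q \<inter> S r s = {}" if "p < 3" "q < 3" "r < 3" "s < 3" "p \<noteq> r" "q \<noteq> s" for p q r s
    using disj [of p q r s] that a [of p r] b [of q s] ab [of p s] ab [of r q] by auto
  have mem: "a p \<in> S p q" "b q \<in> S p q" if "p < 3" "q < 3" for p q
    using arc_between_ends [OF arcs [OF that]] by auto
  have arcs': "arc_between (b q) (a p) (S p q)" if "p < 3" "q < 3" for p q
    using arcs [OF that] arc_between_commute by blast
  have "arc_between (a i) (a j) (S i i \<union> S j i)"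
    using col [of i i j] lt ne by (intro arc_between_join [OF arcs arcs']) auto
  then have P: "arc_between (a i) (b j) (S i i \<union> S j i \<union> S j j)"
    using off [of i i j j] row [of j i j] lt ne by (intro arc_between_join [OF _ arcs]) auto
  have "arc_between (a i) (a k) (S i k \<union> S k k)"
    using col [of i k k] lt ne by (intro arc_between_join [OF arcs arcs']) auto
  then have Q: "arc_between (a i) (b j) (S i k \<union> S k k \<union> S k j)"
    using off [of i k k j] row [of k k j] lt ne by (intro arc_between_join [OF _ arcs]) auto
  show ?thesis
    unfolding J_def
  proof (rule crossing_chords_opposite_sides [OF P Q arcs [OF lt(1,2)] arcs [OF lt(2,3)]])
    show "(S i i \<union> S j i \<union> S j j) \<inter> (S i k \<union> S k k \<union> S k j) \<subseteq> {a i, b j}"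
      using row [of i i k] off [of i i k k] off [of i i k j] off [of j i i k] off [of j i k k]
        off [of j i k j] off [of j j i k] off [of j j k k] col [of j j k] lt ne by blast
    show "(S i i \<union> S j i \<union> S j j) \<inter> S i j \<subseteq> {a i, b j}"
      using row [of i i j] off [of j i i j] col [of j j i] lt ne by blast
    show "(S i k \<union> S k k \<union> S k j) \<inter> S i j \<subseteq> {a i, b j}"
      using row [of i k j] off [of k k i j] col [of k j i] lt ne by blast
    show "S i j \<inter> S j k = {}" using off [of i j j k] lt ne by blast
    show "(S i i \<union> S j i \<union> S j j) \<inter> S j k = {a j}"
      using off [of i i j k] row [of j i k] row [of j j k] mem [of j i] mem [of j k] lt ne by blast
    show "(S i k \<union> S k k \<union> S k j) \<inter> S j k = {b k}"
      using off [of k j j k] col [of i k j] col [of k k j] mem [of i k] mem [of j k] lt ne by blast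
  qed
qed

text \<open>The diagonals S 0 1, S 1 2 and S 2 0 would be pairwise on opposite sides of a curve that
  has only two sides.\<close>

lemma K33_arcs_impossible:
  fixes a b :: "nat \<Rightarrow> complex"
  assumes arcs: "\<And>i j. i < 3 \<Longrightarrow> j < 3 \<Longrightarrow> arc_between (a i) (b j) (S i j)"
    and disj: "\<And>i j k l. i < 3 \<Longrightarrow> j < 3 \<Longrightarrow> k < 3 \<Longrightarrow> l < 3 \<Longrightarrow> (i, j) \<noteq> (k, l) \<Longrightarrow>
      S i j \<inter> S k l \<subseteq> {a i, b j} \<inter> {a k, b l}"
    and inj: "inj_on a {..<3}" "inj_on b {..<3}" "a ` {..<3} \<inter> b ` {..<3} = {}"
  shows False
proof -
  let ?J = "(S 0 0 \<union> S 1 0 \<union> S 1 1) \<union> (S 0 2 \<union> S 2 2 \<union> S 2 1)"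
  \<comment> \<open>Rotating the indices cyclically only rotates the hexagon.\<close>
  have J: "(S 1 1 \<union> S 2 1 \<union> S 2 2) \<union> (S 1 0 \<union> S 0 0 \<union> S 0 2) = ?J"
    "(S 2 2 \<union> S 0 2 \<union> S 0 0) \<union> (S 2 1 \<union> S 1 1 \<union> S 1 0) = ?J" by blast+
  have "S 0 1 \<inter> inside ?J \<noteq> {} \<longleftrightarrow> S 1 2 \<inter> inside ?J = {}"
    using K33_chords [OF arcs disj inj, of 0 1 2] by simp
  moreover have "S 1 2 \<inter> inside ?J \<noteq> {} \<longleftrightarrow> S 2 0 \<inter> inside ?J = {}"
    using K33_chords [OF arcs disj inj, of 1 2 0] unfolding J by simp
  moreover have "S 2 0 \<inter> inside ?J \<noteq> {} \<longleftrightarrow> S 0 1 \<inter> inside ?J = {}"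
    using K33_chords [OF arcs disj inj, of 2 0 1] unfolding J by simp
  ultimately show False by blast
qed

section \<open>Planar drawings and isomorphisms\<close>

lemma planar_drawing_iff:
  "planar_drawing H p \<gamma> \<longleftrightarrow> inj_on p (pverts H) \<and>
    (\<forall>u v. (u, v) \<in> parcs H \<longrightarrow> arc (\<gamma> {u, v}) \<and>
      {pathstart (\<gamma> {u, v}), pathfinish (\<gamma> {u, v})} = {p u, p v} \<and>
      path_image (\<gamma> {u, v}) \<inter> p ` pverts H = {p u, p v}) \<and>
    (\<forall>u v. (u, v) \<in> parcs H \<longrightarrow> (\<forall>x y. (x, y) \<in> parcs H \<longrightarrow> {u, v} \<noteq> {x, y} \<longrightarrow>
      path_image (\<gamma> {u, v}) \<inter> path_image (\<gamma> {x, y}) \<subseteq> p ` ({u, v} \<inter> {x, y})))"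
  by (simp only: planar_drawing_def Ball_def split_paired_All prod.case)

text \<open>Restricts a drawing along an injective homomorphism, whose image may be any subgraph. It
  serves both for invariance under isomorphism and for drawing small graphs inside the cube.\<close>

lemma planar_embed:
  assumes H: "planar H" and inj: "inj_on f (verts G)" and verts: "f ` verts G \<subseteq> verts H"
    and arcs: "\<And>u v. (u, v) \<in> parcs (mk_symmetric G) \<Longrightarrow>
      u \<in> verts G \<and> v \<in> verts G \<and> (f u, f v) \<in> parcs (mk_symmetric H)"
  shows "planar G"
proof -
  obtain p \<gamma> where "planar_drawing (mk_symmetric H) p \<gamma>" using H by (auto simp: planar_def)
  note D = this [unfolded planar_drawing_iff pverts_mk_symmetric]
  note p = D [THEN conjunct1] and \<gamma> = D [THEN conjunct2, THEN conjunct1, rule_format]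
    and cross = D [THEN conjunct2, THEN conjunct2, rule_format]
  have "planar_drawing (mk_symmetric G) (p \<circ> f) (\<lambda>e. \<gamma> (f ` e))"
    unfolding planar_drawing_iff
  proof (intro conjI allI impI)
    show "inj_on (p \<circ> f) (pverts (mk_symmetric G))"
      using inj verts p by (auto intro!: comp_inj_on intro: inj_on_subset)
  next
    fix u v assume uv: "(u, v) \<in> parcs (mk_symmetric G)"
    note a = arcs [OF uv]
    have fuv: "(f u, f v) \<in> parcs (mk_symmetric H)" using a by blast
    note \<gamma>uv = \<gamma> [OF fuv, THEN conjunct1] \<gamma> [OF fuv, THEN conjunct2, THEN conjunct1]
      \<gamma> [OF fuv, THEN conjunct2, THEN conjunct2]
    have "path_image (\<gamma> {f u, f v}) \<inter> (p \<circ> f) ` verts G = {p (f u), p (f v)}"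
    proof
      have "(p \<circ> f) ` verts G \<subseteq> p ` verts H" using verts by auto
      then show "path_image (\<gamma> {f u, f v}) \<inter> (p \<circ> f) ` verts G \<subseteq> {p (f u), p (f v)}"
        using \<gamma>uv(3) by blast
      have "{p (f u), p (f v)} \<subseteq> (p \<circ> f) ` verts G" using a by auto
      then show "{p (f u), p (f v)} \<subseteq> path_image (\<gamma> {f u, f v}) \<inter> (p \<circ> f) ` verts G"
        using \<gamma>uv(3) by blast
    qed
    then show "path_image (\<gamma> (f ` {u, v})) \<inter> (p \<circ> f) ` pverts (mk_symmetric G) = {(p \<circ> f) u, (p \<circ> f) v}"
      by simp
    show "arc (\<gamma> (f ` {u, v}))" using \<gamma>uv(1) by simp
    show "{pathstart (\<gamma> (f ` {u, v})), pathfinish (\<gamma> (f ` {u, v}))} = {(p \<circ> f) u, (p \<circ> f) v}"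
      using \<gamma>uv(2) by simp
  next
    fix u v x y
    assume uv: "(u, v) \<in> parcs (mk_symmetric G)" and xy: "(x, y) \<in> parcs (mk_symmetric G)"
    assume ne: "{u, v} \<noteq> {x, y}"
    show "path_image (\<gamma> (f ` {u, v})) \<inter> path_image (\<gamma> (f ` {x, y})) \<subseteq> (p \<circ> f) ` ({u, v} \<inter> {x, y})"
    proof -
      have sub: "{u, v} \<subseteq> verts G" "{x, y} \<subseteq> verts G" using arcs [OF uv] arcs [OF xy] by auto
      have "f ` {u, v} \<noteq> f ` {x, y}" using inj_on_image_eq_iff [OF inj sub] ne by blast
      then have "path_image (\<gamma> (f ` {u, v})) \<inter> path_image (\<gamma> (f ` {x, y})) \<subseteq> p ` (f ` {u, v} \<inter> f ` {x, y})"
        using cross [of "f u" "f v" "f x" "f y"] arcs [OF uv] arcs [OF xy] by simp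
      also have "f ` {u, v} \<inter> f ` {x, y} = f ` ({u, v} \<inter> {x, y})"
        using inj_on_image_Int [OF inj sub] by simp
      finally show "path_image (\<gamma> (f ` {u, v})) \<inter> path_image (\<gamma> (f ` {x, y}))
        \<subseteq> (p \<circ> f) ` ({u, v} \<inter> {x, y})" by (simp add: image_comp)
    qed
  qed
  then show ?thesis unfolding planar_def by blast
qed

lemma undirected_iso_embedding:
  assumes "undirected_iso G H"
  obtains f where "inj_on f (verts G)" "f ` verts G = verts H"
    "\<And>u v. (u, v) \<in> parcs (mk_symmetric G) \<Longrightarrow>
      u \<in> verts G \<and> v \<in> verts G \<and> (f u, f v) \<in> parcs (mk_symmetric H)"
proof -
  obtain h where h: "pre_digraph.digraph_isomorphism (with_proj (mk_symmetric G)) h"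
    "with_proj (mk_symmetric H) = app_iso h (with_proj (mk_symmetric G))"
    using assms by (auto simp: undirected_iso_def digraph_iso_def)
  have eqs: "verts H = iso_verts h ` verts G"
    "parcs (mk_symmetric H) = iso_arcs h ` parcs (mk_symmetric G)"
    "iso_tail h = fst" "iso_head h = snd"
    using arg_cong [OF h(2), of verts] arg_cong [OF h(2), of arcs]
      arg_cong [OF h(2), of tail] arg_cong [OF h(2), of head] by simp_all
  note hom = h(1) [unfolded pre_digraph.digraph_isomorphism_def]
  show thesis
  proof (rule that [of "iso_verts h"])
    show "inj_on (iso_verts h) (verts G)" "iso_verts h ` verts G = verts H"
      using hom eqs(1) by simp_all
  next
    fix u v assume uv: "(u, v) \<in> parcs (mk_symmetric G)"
    have "wf_digraph (with_proj (mk_symmetric G))" using hom by blast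
    then have "u \<in> verts G" "v \<in> verts G"
      using uv wf_digraph.tail_in_verts wf_digraph.head_in_verts by fastforce+
    \<comment> \<open>The isomorphism carries a separate map of arcs; as tail and head on both sides
      are \<open>fst\<close> and \<open>snd\<close>, it must act as the vertex map on both
      components.\<close>
    moreover have "iso_arcs h (u, v) = (iso_verts h u, iso_verts h v)"
      using hom uv eqs(3,4) by (force simp: prod_eq_iff)
    then have "(iso_verts h u, iso_verts h v) \<in> parcs (mk_symmetric H)"
      using uv eqs(2) by (metis image_eqI)
    ultimately show "u \<in> verts G \<and> v \<in> verts G \<and>
        (iso_verts h u, iso_verts h v) \<in> parcs (mk_symmetric H)" by blast
  qed
qed

lemma undirected_isoI:
  assumes bij: "bij_betw f (verts G) (verts H)"
    and G: "\<And>u v. (u, v) \<in> parcs (mk_symmetric G) \<Longrightarrow> u \<in> verts G \<and> v \<in> verts G"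
    and H: "\<And>x y. (x, y) \<in> parcs (mk_symmetric H) \<Longrightarrow> x \<in> verts H \<and> y \<in> verts H"
    and arcs: "\<And>u v. u \<in> verts G \<Longrightarrow> v \<in> verts G \<Longrightarrow>
      (u, v) \<in> parcs (mk_symmetric G) \<longleftrightarrow> (f u, f v) \<in> parcs (mk_symmetric H)"
  shows "undirected_iso G H"
proof -
  define h where "h = \<lparr>iso_verts = f, iso_arcs = map_prod f f, iso_head = snd, iso_tail = fst\<rparr>"
  have inj: "inj_on f (verts G)" and im: "f ` verts G = verts H" using bij by (auto simp: bij_betw_def)
  have sub: "parcs (mk_symmetric G) \<subseteq> verts G \<times> verts G" using G by auto
  have "inj_on (map_prod f f) (parcs (mk_symmetric G))"
    using map_prod_inj_on [OF inj inj] sub by (rule inj_on_subset)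
  moreover have "wf_digraph (with_proj (mk_symmetric G))" using sub by unfold_locales auto
  ultimately have "pre_digraph.digraph_isomorphism (with_proj (mk_symmetric G)) h"
    using inj by (simp add: pre_digraph.digraph_isomorphism_def h_def)
  moreover have "parcs (mk_symmetric H) = map_prod f f ` parcs (mk_symmetric G)"
  proof (intro equalityI subsetI)
    fix e assume e: "e \<in> parcs (mk_symmetric H)"
    obtain x y where xy: "e = (x, y)" by fastforce
    then obtain u v where "u \<in> verts G" "v \<in> verts G" "x = f u" "y = f v"
      using H [of x y] e im by blast
    then show "e \<in> map_prod f f ` parcs (mk_symmetric G)"
      using arcs [of u v] e xy by (metis image_eqI map_prod_simp)
  next
    fix e assume "e \<in> map_prod f f ` parcs (mk_symmetric G)"
    then show "e \<in> parcs (mk_symmetric H)" using G arcs by auto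
  qed
  then have "with_proj (mk_symmetric H) = app_iso h (with_proj (mk_symmetric G))"
    using im by (simp add: app_iso_def h_def with_proj_def)
  ultimately show ?thesis unfolding undirected_iso_def digraph_iso_def by blast
qed

lemma planar_undirected_iso:
  assumes "undirected_iso G H" "planar H"
  shows "planar G"
  using undirected_iso_embedding [OF assms(1)] planar_embed [OF assms(2)] by (metis order_refl)

text \<open>Edges are treated as convex hulls of their two ends, which makes the conditions
  independent of orientation.\<close>

lemma planar_straight_line:
  assumes inj: "inj_on p (pverts H)"
    and arcs: "\<And>u v. (u, v) \<in> parcs H \<Longrightarrow> u \<in> pverts H \<and> v \<in> pverts H \<and> u \<noteq> v"
    and vert: "\<And>u v w. (u, v) \<in> parcs H \<Longrightarrow> w \<in> pverts H \<Longrightarrow> p w \<in> convex hull (p ` {u, v}) \<Longrightarrow> w \<in> {u, v}"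
    and cross: "\<And>u v x y. (u, v) \<in> parcs H \<Longrightarrow> (x, y) \<in> parcs H \<Longrightarrow> {u, v} \<noteq> {x, y} \<Longrightarrow>
      convex hull (p ` {u, v}) \<inter> convex hull (p ` {x, y}) \<subseteq> p ` ({u, v} \<inter> {x, y})"
  shows "\<exists>\<gamma>. planar_drawing H p \<gamma>"
proof -
  \<comment> \<open>A drawing is indexed by unordered pairs, so a direction is chosen arbitrarily;
    the image of the segment does not depend on it.\<close>
  define \<gamma> where "\<gamma> e = (let (u, v) = SOME (u, v). e = {u, v} in linepath (p u) (p v))" for e
  have \<gamma>: "\<exists>x y. {x, y} = {u, v} \<and> \<gamma> {u, v} = linepath (p x) (p y)" for u v
  proof -
    have "\<exists>q. case q of (x, y) \<Rightarrow> {u, v} = {x, y}" by (intro exI [of _ "(u, v)"]) simp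
    from someI_ex [OF this] show ?thesis
      unfolding \<gamma>_def by (metis (mono_tags, lifting) case_prod_beta' prod.collapse)
  qed
  have im: "path_image (\<gamma> {u, v}) = convex hull (p ` {u, v})" for u v
    using \<gamma> [of u v] by (metis image_empty image_insert path_image_linepath segment_convex_hull)
  have "planar_drawing H p \<gamma>"
    unfolding planar_drawing_iff
  proof (intro conjI allI impI)
    fix u v assume uv: "(u, v) \<in> parcs H"
    obtain x y where xy: "{x, y} = {u, v}" "\<gamma> {u, v} = linepath (p x) (p y)" using \<gamma> by blast
    have "x \<noteq> y" "x \<in> pverts H" "y \<in> pverts H" using xy(1) arcs [OF uv] by (auto simp: doubleton_eq_iff)
    then have "p x \<noteq> p y" using inj by (auto dest: inj_onD)
    then have "arc (\<gamma> {u, v})" unfolding xy(2) by (rule arc_linepath)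
    moreover have "{pathstart (\<gamma> {u, v}), pathfinish (\<gamma> {u, v})} = {p u, p v}"
      unfolding xy(2) using xy(1) by (auto simp: doubleton_eq_iff)
    moreover have "path_image (\<gamma> {u, v}) \<inter> p ` pverts H = {p u, p v}"
      unfolding im using vert [OF uv] arcs [OF uv] by (auto intro: hull_inc)
    ultimately show "arc (\<gamma> {u, v})"
      "{pathstart (\<gamma> {u, v}), pathfinish (\<gamma> {u, v})} = {p u, p v}"
      "path_image (\<gamma> {u, v}) \<inter> p ` pverts H = {p u, p v}" by blast+
  next
    show "path_image (\<gamma> {u, v}) \<inter> path_image (\<gamma> {x, y}) \<subseteq> p ` ({u, v} \<inter> {x, y})"
      if "(u, v) \<in> parcs H" "(x, y) \<in> parcs H" "{u, v} \<noteq> {x, y}" for u v x y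
      using cross [OF that] unfolding im .
  qed (rule inj)
  then show ?thesis by blast
qed

section \<open>Subdivisions of the complete bipartite graph on 3 + 3 vertices\<close>

definition path_edges :: "'a list \<Rightarrow> 'a set set" where
  "path_edges xs = (\<lambda>(u, v). {u, v}) ` set (zip xs (tl xs))"

lemma path_edges_Cons [simp]: "path_edges (x # y # zs) = insert {x, y} (path_edges (y # zs))"
  by (simp add: path_edges_def)

lemma path_edges_singleton [simp]: "path_edges [x] = {}"
  by (simp add: path_edges_def)

lemma path_edges_subset: "e \<in> path_edges xs \<Longrightarrow> e \<subseteq> set xs"
  by (induction xs rule: induct_list012) (auto simp: path_edges_def)

lemma path_edgesE:
  assumes "successively (\<lambda>u v. (u, v) \<in> E) xs" "e \<in> path_edges xs"
  obtains u v where "e = {u, v}" "(u, v) \<in> E"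
  using assms by (induction xs rule: induct_list012) (auto simp: path_edges_def)

text \<open>Without loops every edge has two ends, so paths with at most one common vertex share no
  edge. The crossing condition then applies to each pair of their edges.\<close>

lemma path_drawing_Int:
  assumes draw: "planar_drawing H p \<gamma>" and loopfree: "\<And>v. (v, v) \<notin> parcs H"
    and xs: "successively (\<lambda>u v. (u, v) \<in> parcs H) xs"
    and ys: "successively (\<lambda>u v. (u, v) \<in> parcs H) ys"
    and single: "set xs \<inter> set ys \<subseteq> {z}"
  shows "(\<Union>e\<in>path_edges xs. path_image (\<gamma> e)) \<inter> (\<Union>e\<in>path_edges ys. path_image (\<gamma> e))
    \<subseteq> p ` (set xs \<inter> set ys)"
proof
  fix w
  assume "w \<in> (\<Union>e\<in>path_edges xs. path_image (\<gamma> e)) \<inter> (\<Union>e\<in>path_edges ys. path_image (\<gamma> e))"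
  then obtain e e' where e: "e \<in> path_edges xs" "w \<in> path_image (\<gamma> e)"
    and e': "e' \<in> path_edges ys" "w \<in> path_image (\<gamma> e')" by blast
  obtain u v where uv: "e = {u, v}" "(u, v) \<in> parcs H" using path_edgesE [OF xs e(1)] .
  obtain x y where xy: "e' = {x, y}" "(x, y) \<in> parcs H" using path_edgesE [OF ys e'(1)] .
  have sub: "e \<subseteq> set xs" "e' \<subseteq> set ys" using path_edges_subset e(1) e'(1) by blast+
  have "u \<noteq> v" using uv(2) loopfree by blast
  then have "e \<noteq> e'" using sub single uv(1) by blast
  then have "path_image (\<gamma> e) \<inter> path_image (\<gamma> e') \<subseteq> p ` (e \<inter> e')"
    using draw [unfolded planar_drawing_iff, THEN conjunct2, THEN conjunct2, rule_format, OF uv(2) xy(2)]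
    unfolding uv(1) xy(1) by blast
  then show "w \<in> p ` (set xs \<inter> set ys)" using e(2) e'(2) sub by blast
qed

lemma edge_drawing_arc:
  assumes "planar_drawing H p \<gamma>" "(x, y) \<in> parcs H"
  shows "arc_between (p x) (p y) (path_image (\<gamma> {x, y}))"
proof -
  note D = assms(1) [unfolded planar_drawing_iff, THEN conjunct2, THEN conjunct1, rule_format, OF assms(2)]
  have "arc_between (pathstart (\<gamma> {x, y})) (pathfinish (\<gamma> {x, y})) (path_image (\<gamma> {x, y}))"
    using D unfolding arc_between_def by blast
  then show ?thesis
    using D arc_between_commute by (metis doubleton_eq_iff)
qed

lemma path_drawing_arc:
  assumes draw: "planar_drawing H p \<gamma>" and loopfree: "\<And>v. (v, v) \<notin> parcs H"
    and "successively (\<lambda>u v. (u, v) \<in> parcs H) (x # y # zs)" "distinct (x # y # zs)"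
  shows "arc_between (p x) (p (last (y # zs))) (\<Union>e\<in>path_edges (x # y # zs). path_image (\<gamma> e))"
  using assms(3,4)
proof (induction zs arbitrary: x y)
  case Nil
  then show ?case using edge_drawing_arc [OF draw, of x y] by simp
next
  case (Cons z zs)
  have 1: "arc_between (p x) (p y) (\<Union>e\<in>path_edges [x, y]. path_image (\<gamma> e))"
    using edge_drawing_arc [OF draw, of x y] Cons.prems by simp
  have 2: "arc_between (p y) (p (last (z # zs))) (\<Union>e\<in>path_edges (y # z # zs). path_image (\<gamma> e))"
    using Cons.prems by (intro Cons.IH) auto
  have s: "set [x, y] \<inter> set (y # z # zs) = {y}" using Cons.prems(2) by auto
  have "(\<Union>e\<in>path_edges [x, y]. path_image (\<gamma> e)) \<inter> (\<Union>e\<in>path_edges (y # z # zs). path_image (\<gamma> e))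
      \<subseteq> p ` (set [x, y] \<inter> set (y # z # zs))"
    using Cons.prems s by (intro path_drawing_Int [OF draw loopfree, where z = y]) auto
  then have 3: "(\<Union>e\<in>path_edges [x, y]. path_image (\<gamma> e)) \<inter> (\<Union>e\<in>path_edges (y # z # zs). path_image (\<gamma> e))
      \<subseteq> {p y}" unfolding s by simp
  show ?case using arc_between_join [OF 1 2 3] by simp
qed

lemma K33_subdivision_not_planar:
  fixes a b :: "nat \<Rightarrow> 'v" and W :: "nat \<Rightarrow> nat \<Rightarrow> 'v list"
  assumes draw: "planar_drawing H p \<gamma>" and loopfree: "\<And>v. (v, v) \<notin> parcs H"
    and verts: "a ` {..<3} \<union> b ` {..<3} \<subseteq> pverts H"
    and paths: "\<And>i j. i < 3 \<Longrightarrow> j < 3 \<Longrightarrow> successively (\<lambda>u v. (u, v) \<in> parcs H) (W i j) \<and>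
      distinct (W i j) \<and> W i j \<noteq> [] \<and> hd (W i j) = a i \<and> last (W i j) = b j"
    and disj: "\<And>i j k l. i < 3 \<Longrightarrow> j < 3 \<Longrightarrow> k < 3 \<Longrightarrow> l < 3 \<Longrightarrow> (i, j) \<noteq> (k, l) \<Longrightarrow>
      set (W i j) \<inter> set (W k l) \<subseteq> {a i, b j} \<inter> {a k, b l}"
    and inj: "inj_on a {..<3}" "inj_on b {..<3}" "a ` {..<3} \<inter> b ` {..<3} = {}"
  shows False
proof -
  define S where "S i j = (\<Union>e\<in>path_edges (W i j). path_image (\<gamma> e))" for i j
  have p: "inj_on p (pverts H)" using draw by (simp add: planar_drawing_iff)
  have ab: "a i \<noteq> b j" if "i < 3" "j < 3" for i j using inj(3) that by blast
  show False
  proof (rule K33_arcs_impossible [of "p \<circ> a" "p \<circ> b" S])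
    fix i j :: nat assume ij: "i < 3" "j < 3"
    note W = paths [OF ij]
    obtain x zs where 1: "W i j = x # zs" using W by (cases "W i j") auto
    then obtain y ws where 2: "W i j = x # y # ws" using W ab [OF ij] by (cases zs) auto
    have "successively (\<lambda>u v. (u, v) \<in> parcs H) (x # y # ws)" "distinct (x # y # ws)"
      using W unfolding 2 by blast+
    note arc = path_drawing_arc [OF draw loopfree this]
    have "x = a i" "last (y # ws) = b j" using W unfolding 2 by simp_all
    then show "arc_between ((p \<circ> a) i) ((p \<circ> b) j) (S i j)"
      using arc unfolding S_def 2 by simp
  next
    fix i j k l :: nat assume *: "i < 3" "j < 3" "k < 3" "l < 3" "(i, j) \<noteq> (k, l)"
    \<comment> \<open>Different index pairs agree in at most one index; so two of the nine paths
      share at most one vertex.\<close>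
    have "\<exists>z. {a i, b j} \<inter> {a k, b l} \<subseteq> {z}"
    proof (cases "i = k")
      case True
      then have "b j \<noteq> b l" using * inj(2) by (auto dest: inj_onD)
      then show ?thesis using ab * by blast
    next
      case False
      then have "a i \<noteq> a k" using * inj(1) by (auto dest: inj_onD)
      then show ?thesis using ab * by blast
    qed
    then obtain z where "set (W i j) \<inter> set (W k l) \<subseteq> {z}" using disj [OF *] by blast
    then have "S i j \<inter> S k l \<subseteq> p ` (set (W i j) \<inter> set (W k l))"
      unfolding S_def using paths * by (intro path_drawing_Int [OF draw loopfree]) auto
    also have "\<dots> \<subseteq> p ` ({a i, b j} \<inter> {a k, b l})" using disj [OF *] by (rule image_mono)
    also have "\<dots> \<subseteq> {(p \<circ> a) i, (p \<circ> b) j} \<inter> {(p \<circ> a) k, (p \<circ> b) l}" by auto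
    finally show "S i j \<inter> S k l \<subseteq> {(p \<circ> a) i, (p \<circ> b) j} \<inter> {(p \<circ> a) k, (p \<circ> b) l}" .
  next
    show "inj_on (p \<circ> a) {..<3}" "inj_on (p \<circ> b) {..<3}"
      using inj p verts by (auto intro!: comp_inj_on intro: inj_on_subset)
    have "p ` (a ` {..<3}) \<inter> p ` (b ` {..<3}) = p ` (a ` {..<3} \<inter> b ` {..<3})"
      using verts by (intro inj_on_image_Int [OF p, symmetric]) auto
    then show "(p \<circ> a) ` {..<3} \<inter> (p \<circ> b) ` {..<3} = {}"
      unfolding image_comp [symmetric] inj(3) by simp
  qed
qed

lemma K33_not_planar:
  assumes loopfree: "\<And>v. (v, v) \<notin> parcs (mk_symmetric G)"
    and verts: "{a0, a1, a2, b0, b1, b2} \<subseteq> verts G"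
    and dist: "distinct [a0, a1, a2, b0, b1, b2]"
    and arcs: "\<forall>a\<in>{a0, a1, a2}. \<forall>b\<in>{b0, b1, b2}. (a, b) \<in> parcs (mk_symmetric G)"
  shows "\<not> planar G"
proof
  assume "planar G"
  then obtain p \<gamma> where draw: "planar_drawing (mk_symmetric G) p \<gamma>" by (auto simp: planar_def)
  let ?a = "\<lambda>i. [a0, a1, a2] ! i" and ?b = "\<lambda>i. [b0, b1, b2] ! i"
  have lt3: "{..<3} = {0, 1, 2 :: nat}" by auto
  have in3: "i = 0 \<or> i = 1 \<or> i = 2" if "i < 3" for i :: nat using that by auto
  have mem: "?a i \<in> {a0, a1, a2}" "?b i \<in> {b0, b1, b2}" if "i < 3" for i
    using in3 [OF that] by auto
  have inj: "inj_on ?a {..<3}" "inj_on ?b {..<3}" "?a ` {..<3} \<inter> ?b ` {..<3} = {}"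
    using dist unfolding lt3 by auto
  have ne: "?a i \<noteq> ?b j" if "i < 3" "j < 3" for i j using inj(3) that by blast
  show False
  proof (rule K33_subdivision_not_planar [OF draw loopfree _ _ _ inj, of "\<lambda>i j. [?a i, ?b j]"])
    show "?a ` {..<3} \<union> ?b ` {..<3} \<subseteq> pverts (mk_symmetric G)"
      using verts unfolding lt3 by simp
  next
    fix i j :: nat assume ij: "i < 3" "j < 3"
    have "(?a i, ?b j) \<in> parcs (mk_symmetric G)"
      using arcs mem(1) [OF ij(1)] mem(2) [OF ij(2)] by blast
    then show "successively (\<lambda>u v. (u, v) \<in> parcs (mk_symmetric G)) [?a i, ?b j] \<and>
        distinct [?a i, ?b j] \<and> [?a i, ?b j] \<noteq> [] \<and> hd [?a i, ?b j] = ?a i \<and> last [?a i, ?b j] = ?b j"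
      using ne [OF ij] by simp
  qed auto
qed

section \<open>The four-dimensional and the three-dimensional cube\<close>

definition hamming4 :: "bool \<times> bool \<times> bool \<times> bool \<Rightarrow> bool \<times> bool \<times> bool \<times> bool \<Rightarrow> nat" where
  "hamming4 = (\<lambda>(p, q, r, s) (p', q', r', s').
     of_bool (p \<noteq> p') + of_bool (q \<noteq> q') + of_bool (r \<noteq> r') + of_bool (s \<noteq> s'))"

text \<open>Take three even vertices a and three odd vertices b of the 3-cube where the last
  coordinate is False. Seven of the nine pairs are edges of that cube. The pairs (a 2, b 1) and (a
  1, b 2) are antipodal there and are joined by longer paths.\<close>

lemma tesseract_not_planar:
  fixes f :: "bool \<times> bool \<times> bool \<times> bool \<Rightarrow> 'v"
  assumes loopfree: "\<And>v. (v, v) \<notin> parcs (mk_symmetric G)"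
    and inj: "inj f" and verts: "range f \<subseteq> verts G"
    and arcs: "\<And>x y. hamming4 x y = 1 \<Longrightarrow> (f x, f y) \<in> parcs (mk_symmetric G)"
  shows "\<not> planar G"
proof
  assume "planar G"
  then obtain p \<gamma> where draw: "planar_drawing (mk_symmetric G) p \<gamma>" by (auto simp: planar_def)
  define a where "a i = [(False, False, False, False), (True, True, False, False),
    (True, False, True, False)] ! i" for i
  define b where "b i = [(True, False, False, False), (False, True, False, False),
    (False, False, True, False)] ! i" for i
  \<comment> \<open>The path from a 2 to b 1 uses the two vertices of the 3-cube that are still
    free; the path from a 1 to b 2 runs through the parallel 3-cube, where the last coordinate is
    True.\<close>
  define W where "W i j = (if (i, j) = (1, 2) then
      [a 1, (True, True, False, True), (True, False, False, True), (True, False, True, True),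
        (False, False, True, True), b 2]
    else if (i, j) = (2, 1) then
      [a 2, (True, True, True, False), (False, True, True, False), b 1]
    else [a i, b j])" for i j :: nat
  have lt3: "{..<3} = {0, 1, 2 :: nat}" by auto
  have in3: "i = 0 \<or> i = 1 \<or> i = 2" if "i < 3" for i :: nat using that by auto
  have W: "successively (\<lambda>x y. hamming4 x y = 1) (W i j) \<and> distinct (W i j) \<and>
      W i j \<noteq> [] \<and> hd (W i j) = a i \<and> last (W i j) = b j" if "i < 3" "j < 3" for i j
    using in3 [OF that(1)] in3 [OF that(2)]
    by (elim disjE) (simp_all add: W_def a_def b_def hamming4_def)
  have disj: "set (W i j) \<inter> set (W k l) \<subseteq> {a i, b j} \<inter> {a k, b l}"
    if "i < 3" "j < 3" "k < 3" "l < 3" "(i, j) \<noteq> (k, l)" for i j k l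
    using in3 [OF that(1)] in3 [OF that(2)] in3 [OF that(3)] in3 [OF that(4)] that(5)
    by (elim disjE) (simp_all add: W_def a_def b_def)
  have inj3: "inj_on a {..<3}" "inj_on b {..<3}" "a ` {..<3} \<inter> b ` {..<3} = {}"
    unfolding lt3 by (auto simp: a_def b_def)
  show False
  proof (rule K33_subdivision_not_planar [OF draw loopfree, of "f \<circ> a" "f \<circ> b" "\<lambda>i j. map f (W i j)"])
    show "(f \<circ> a) ` {..<3} \<union> (f \<circ> b) ` {..<3} \<subseteq> pverts (mk_symmetric G)"
      using verts by auto
  next
    fix i j :: nat assume ij: "i < 3" "j < 3"
    have "successively (\<lambda>x y. (f x, f y) \<in> parcs (mk_symmetric G)) (W i j)"
      using W [OF ij] arcs by (auto intro: successively_mono)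
    then show "successively (\<lambda>u v. (u, v) \<in> parcs (mk_symmetric G)) (map f (W i j)) \<and>
        distinct (map f (W i j)) \<and> map f (W i j) \<noteq> [] \<and> hd (map f (W i j)) = (f \<circ> a) i \<and>
        last (map f (W i j)) = (f \<circ> b) j"
      using W [OF ij] inj by (simp add: successively_map distinct_map hd_map last_map inj_on_subset [OF inj])
  next
    fix i j k l :: nat assume *: "i < 3" "j < 3" "k < 3" "l < 3" "(i, j) \<noteq> (k, l)"
    have "set (map f (W i j)) \<inter> set (map f (W k l)) = f ` (set (W i j) \<inter> set (W k l))"
      using inj by (simp add: image_Int)
    then show "set (map f (W i j)) \<inter> set (map f (W k l)) \<subseteq>
        {(f \<circ> a) i, (f \<circ> b) j} \<inter> {(f \<circ> a) k, (f \<circ> b) l}"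
      using disj [OF *] by auto
  next
    show "inj_on (f \<circ> a) {..<3}" "inj_on (f \<circ> b) {..<3}"
      using inj3 inj by (auto intro!: comp_inj_on intro: inj_on_subset)
    have "f ` (a ` {..<3}) \<inter> f ` (b ` {..<3}) = f ` (a ` {..<3} \<inter> b ` {..<3})"
      using inj by (simp add: image_Int)
    then show "(f \<circ> a) ` {..<3} \<inter> (f \<circ> b) ` {..<3} = {}"
      unfolding image_comp [symmetric] inj3(3) by simp
  qed
qed

text \<open>The horizontal square at height \<open>z\<close> is scaled by \<open>1 + z\<close>. The map is affine in each coordinate
  and injective on the side faces, which contain all edges of the cube.\<close>

definition cube_proj :: "real \<times> real \<times> real \<Rightarrow> complex" where
  "cube_proj = (\<lambda>(x, y, z). Complex ((2 * x - 1) * (1 + z)) ((2 * y - 1) * (1 + z)))"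

definition cube_sides :: "(real \<times> real \<times> real) set" where
  "cube_sides = {(x, y, z). x \<in> {0..1} \<and> y \<in> {0..1} \<and> z \<in> {0..1} \<and> (x \<in> {0, 1} \<or> y \<in> {0, 1})}"

text \<open>On a side face one of |2x - 1| and |2y - 1| is 1 and the other at most 1, so the maximum
  norm of the image is 1 + z. This recovers the height, and then x and y because 1 + z is
  positive.\<close>

lemma inj_on_cube_proj: "inj_on cube_proj cube_sides"
proof (rule inj_onI)
  fix u v :: "real \<times> real \<times> real"
  assume in1: "u \<in> cube_sides" and in2: "v \<in> cube_sides" and eq: "cube_proj u = cube_proj v"
  have max: "max \<bar>Re (cube_proj w)\<bar> \<bar>Im (cube_proj w)\<bar> = 1 + snd (snd w)" if "w \<in> cube_sides" for w
  proof -
    obtain x y z where w: "w = (x, y, z)" by (metis prod_cases3)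
    have "max \<bar>2 * x - 1\<bar> \<bar>2 * y - 1\<bar> = 1" "1 + z \<ge> 0"
      using that unfolding w by (auto simp: cube_sides_def abs_if max_def)
    then show ?thesis
      using max_mult_distrib_right [of "\<bar>2 * x - 1\<bar>" "\<bar>2 * y - 1\<bar>" "1 + z"]
      by (simp add: w cube_proj_def abs_mult)
  qed
  have "snd (snd u) = snd (snd v)" using max [OF in1] max [OF in2] eq by simp
  moreover have "1 + snd (snd u) > 0" using in1 by (auto simp: cube_sides_def)
  ultimately show "u = v" using eq by (auto simp: cube_proj_def split: prod.splits)
qed

text \<open>\<open>cube_edge e B\<close>: the edge with end vertices \<open>e\<close> spans the segment \<open>B\<close> in space.\<close>

inductive cube_edge :: "(int \<times> int \<times> int) set \<Rightarrow> (real \<times> real \<times> real) set \<Rightarrow> bool" where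
  x: "b \<in> {0, 1} \<Longrightarrow> c \<in> {0, 1} \<Longrightarrow>
    cube_edge {(0, b, c), (1, b, c)} ({0..1} \<times> {of_int b} \<times> {of_int c})"
| y: "b \<in> {0, 1} \<Longrightarrow> c \<in> {0, 1} \<Longrightarrow>
    cube_edge {(b, 0, c), (b, 1, c)} ({of_int b} \<times> {0..1} \<times> {of_int c})"
| z: "b \<in> {0, 1} \<Longrightarrow> c \<in> {0, 1} \<Longrightarrow>
    cube_edge {(b, c, 0), (b, c, 1)} ({of_int b} \<times> {of_int c} \<times> {0..1})"

definition cube_vertex :: "int \<times> int \<times> int \<Rightarrow> real \<times> real \<times> real" where
  "cube_vertex = (\<lambda>(a, b, c). (of_int a, of_int b, of_int c))"

lemma cube_edge_sides: "cube_edge e B \<Longrightarrow> B \<subseteq> cube_sides"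
  by (elim cube_edge.cases) (auto simp: cube_sides_def)

lemma cube_edge_vertex:
  assumes "cube_edge e B" "w \<in> {0, 1} \<times> {0, 1} \<times> {0, 1}" "cube_vertex w \<in> B"
  shows "w \<in> e"
  using assms by (cases rule: cube_edge.cases) (auto simp: cube_vertex_def)

text \<open>A point of an edge other than its ends has exactly one coordinate strictly between 0 and
  1. That coordinate gives the direction, and the other two locate the edge. The right-hand side
  mentions only the point, so two edges through it coincide.\<close>

lemma cube_edge_determined:
  assumes "cube_edge e B" "(x, y, z) \<in> B" "(x, y, z) \<notin> cube_vertex ` e"
  shows "e = {a \<in> {0, 1}. x \<in> {0, 1} \<longrightarrow> x = of_int a} \<times> {a \<in> {0, 1}. y \<in> {0, 1} \<longrightarrow> y = of_int a} \<times>
    {a \<in> {0, 1}. z \<in> {0, 1} \<longrightarrow> z = of_int a}"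
proof -
  have free: "{a \<in> {0, 1 :: int}. t \<in> {0, 1} \<longrightarrow> t = of_int a} = {0, 1}" if "t \<noteq> 0" "t \<noteq> 1" for t :: real
    using that by auto
  have fixd: "{a \<in> {0, 1 :: int}. of_int b \<in> {0, 1 :: real} \<longrightarrow> of_int b = (of_int a :: real)} = {b}"
    if "b \<in> {0, 1}" for b
    using that by auto
  from assms(1) show ?thesis
  proof (cases rule: cube_edge.cases)
    case (x b c)
    then have "x \<noteq> 0" "x \<noteq> 1" "y = of_int b" "z = of_int c"
      using assms(2,3) by (auto simp: cube_vertex_def)
    then show ?thesis using fixd [OF x(3)] fixd [OF x(4)] free [of x] unfolding x(1) by auto
  next
    case (y b c)
    then have "y \<noteq> 0" "y \<noteq> 1" "x = of_int b" "z = of_int c"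
      using assms(2,3) by (auto simp: cube_vertex_def)
    then show ?thesis using fixd [OF y(3)] fixd [OF y(4)] free [of y] unfolding y(1) by auto
  next
    case (z b c)
    then have "z \<noteq> 0" "z \<noteq> 1" "x = of_int b" "y = of_int c"
      using assms(2,3) by (auto simp: cube_vertex_def)
    then show ?thesis using fixd [OF z(3)] fixd [OF z(4)] free [of z] unfolding z(1) by auto
  qed
qed

text \<open>A common point that is an end of neither edge would determine both. Otherwise it is a
  vertex of the cube lying on both segments, hence an end of both.\<close>

lemma cube_edge_Int:
  assumes "cube_edge e B" "cube_edge e' B'" "e \<noteq> e'"
  shows "B \<inter> B' \<subseteq> cube_vertex ` (e \<inter> e')"
proof
  fix q assume q: "q \<in> B \<inter> B'"
  have cube: "d \<subseteq> {0, 1} \<times> {0, 1} \<times> {0, 1}" if "cube_edge d C" for d C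
    using that by (cases rule: cube_edge.cases) auto
  obtain x y z where xyz: "q = (x, y, z)" by (metis prod_cases3)
  have "q \<in> cube_vertex ` e \<or> q \<in> cube_vertex ` e'"
  proof (rule ccontr)
    assume "\<not> ?thesis"
    then have n: "(x, y, z) \<notin> cube_vertex ` e" "(x, y, z) \<notin> cube_vertex ` e'" unfolding xyz by auto
    have m: "(x, y, z) \<in> B" "(x, y, z) \<in> B'" using q unfolding xyz by auto
    have "e = e'"
      by (rule trans [OF cube_edge_determined [OF assms(1) m(1) n(1)]
            cube_edge_determined [OF assms(2) m(2) n(2), symmetric]])
    then show False using assms(3) by contradiction
  qed
  then obtain w where w: "q = cube_vertex w" "w \<in> e \<or> w \<in> e'" by (elim disjE imageE) simp_all
  have "w \<in> {0, 1} \<times> {0, 1} \<times> {0, 1}"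
    using w(2) subsetD [OF cube [OF assms(1)]] subsetD [OF cube [OF assms(2)]] by (rule disjE)
  moreover have "cube_vertex w \<in> B" "cube_vertex w \<in> B'" using q unfolding w(1) by simp_all
  ultimately have "w \<in> e \<inter> e'"
    by (intro IntI cube_edge_vertex [OF assms(1)] cube_edge_vertex [OF assms(2)])
  then show "q \<in> cube_vertex ` (e \<inter> e')" unfolding w(1) by (rule imageI)
qed

text \<open>Only one coordinate varies along an edge, so affinity in each coordinate makes the image
  a straight segment.\<close>

lemma cube_edge_hull:
  assumes "cube_edge e B"
  shows "convex hull ((cube_proj \<circ> cube_vertex) ` e) \<subseteq> cube_proj ` B"
proof -
  have *: "convex hull ((cube_proj \<circ> cube_vertex) ` {u, v}) \<subseteq> cube_proj ` B"
    if "\<And>t. t \<in> {0..1} \<Longrightarrow> g t \<in> B" "\<And>t. (1 - t) *\<^sub>R cube_proj (cube_vertex u) + t *\<^sub>R cube_proj (cube_vertex v) = cube_proj (g t)"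
    for u v g
  proof
    note g = that
    fix z assume "z \<in> convex hull ((cube_proj \<circ> cube_vertex) ` {u, v})"
    then have "z \<in> closed_segment (cube_proj (cube_vertex u)) (cube_proj (cube_vertex v))"
      by (simp add: segment_convex_hull)
    then obtain t where "t \<in> {0..1}" "z = cube_proj (g t)" using g(2) by (auto simp: closed_segment_def)
    then show "z \<in> cube_proj ` B" using g(1) by blast
  qed
  from assms show ?thesis
  proof (cases rule: cube_edge.cases)
    case (x b c)
    show ?thesis unfolding x(1)
      by (rule * [of "\<lambda>t. (t, of_int b, of_int c)"])
        (auto simp: x(2) cube_proj_def cube_vertex_def complex_eq_iff algebra_simps)
  next
    case (y b c)
    show ?thesis unfolding y(1)
      by (rule * [of "\<lambda>t. (of_int b, t, of_int c)"])
        (auto simp: y(2) cube_proj_def cube_vertex_def complex_eq_iff algebra_simps)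
  next
    case (z b c)
    show ?thesis unfolding z(1)
      by (rule * [of "\<lambda>t. (of_int b, of_int c, t)"])
        (auto simp: z(2) cube_proj_def cube_vertex_def complex_eq_iff algebra_simps)
  qed
qed

lemma verts_cube_graph: "pverts cube_graph = {0, 1} \<times> {0, 1} \<times> {0, 1}"
  by (simp add: cube_graph_def)

lemma arcs_mk_symmetric_cube_graph: "parcs (mk_symmetric (with_proj cube_graph)) = parcs cube_graph"
proof -
  have "(v, u) \<in> parcs cube_graph" if "(u, v) \<in> parcs cube_graph" for u v
  proof -
    obtain a b c a' b' c' where "u = (a, b, c)" "v = (a', b', c')" by (metis prod_cases3)
    with that show ?thesis
      by (simp add: cube_graph_def abs_minus_commute [of a'] abs_minus_commute [of b']
          abs_minus_commute [of c'])
  qed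
  then show ?thesis by (fastforce simp: mk_symmetric_def)
qed

lemma cube_graph_edge:
  assumes "(u, v) \<in> parcs cube_graph"
  obtains B where "cube_edge {u, v} B"
proof -
  obtain a b c a' b' c' where uv: "u = (a, b, c)" "v = (a', b', c')" by (metis prod_cases3)
  have m: "a \<in> {0, 1}" "b \<in> {0, 1}" "c \<in> {0, 1}" "a' \<in> {0, 1}" "b' \<in> {0, 1}" "c' \<in> {0, 1}"
    and d: "\<bar>a - a'\<bar> + \<bar>b - b'\<bar> + \<bar>c - c'\<bar> = 1"
    using assms unfolding uv cube_graph_def by simp_all
  have pair: "{x, y} = {0, 1}" if "x \<in> {0, 1}" "y \<in> {0, 1}" "x \<noteq> y" for x y :: int
    using that by auto
  consider "a \<noteq> a'" "b = b'" "c = c'" | "a = a'" "b \<noteq> b'" "c = c'" | "a = a'" "b = b'" "c \<noteq> c'"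
    using d by linarith
  then show thesis
  proof cases
    case 1
    then have "{u, v} = (\<lambda>t. (t, b, c)) ` {a, a'}" unfolding uv by simp
    also have "{a, a'} = {0, 1}" using m 1 by (intro pair)
    finally have "{u, v} = {(0, b, c), (1, b, c)}" by simp
    then show ?thesis using cube_edge.x [OF m(2,3)] that by simp
  next
    case 2
    then have "{u, v} = (\<lambda>t. (a, t, c)) ` {b, b'}" unfolding uv by simp
    also have "{b, b'} = {0, 1}" using m 2 by (intro pair)
    finally have "{u, v} = {(a, 0, c), (a, 1, c)}" by simp
    then show ?thesis using cube_edge.y [OF m(1,3)] that by simp
  next
    case 3
    then have "{u, v} = (\<lambda>t. (a, b, t)) ` {c, c'}" unfolding uv by simp
    also have "{c, c'} = {0, 1}" using m 3 by (intro pair)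
    finally have "{u, v} = {(a, b, 0), (a, b, 1)}" by simp
    then show ?thesis using cube_edge.z [OF m(1,2)] that by simp
  qed
qed

lemma cube_graph_arcD:
  assumes "(u, v) \<in> parcs cube_graph"
  shows "u \<in> pverts cube_graph" "v \<in> pverts cube_graph" "u \<noteq> v"
proof -
  obtain a b c a' b' c' where uv: "u = (a, b, c)" "v = (a', b', c')" by (metis prod_cases3)
  have "a \<in> {0, 1}" "b \<in> {0, 1}" "c \<in> {0, 1}" "a' \<in> {0, 1}" "b' \<in> {0, 1}" "c' \<in> {0, 1}"
    using assms unfolding uv cube_graph_def by simp_all
  then show "u \<in> pverts cube_graph" "v \<in> pverts cube_graph"
    unfolding uv verts_cube_graph mem_Sigma_iff by (iprover intro: conjI)+
  have "\<bar>a - a'\<bar> + \<bar>b - b'\<bar> + \<bar>c - c'\<bar> = 1"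
    using assms unfolding uv cube_graph_def by simp
  then show "u \<noteq> v" unfolding uv by auto
qed

text \<open>Intersections are computed in space, where edges are axis-parallel, and carried to the
  plane by injectivity on the side faces.\<close>

lemma planar_cube_graph: "planar (with_proj cube_graph)"
proof -
  let ?H = "mk_symmetric (with_proj cube_graph)"
  have sides: "cube_vertex w \<in> cube_sides" if "w \<in> pverts cube_graph" for w
    using that by (auto simp: verts_cube_graph cube_vertex_def cube_sides_def)
  have inj: "inj cube_vertex" by (auto simp: inj_def cube_vertex_def)
  have "\<exists>\<gamma>. planar_drawing ?H (cube_proj \<circ> cube_vertex) \<gamma>"
  proof (rule planar_straight_line)
    show "inj_on (cube_proj \<circ> cube_vertex) (pverts ?H)"
      using sides by (intro comp_inj_on inj_on_subset [OF inj] inj_on_subset [OF inj_on_cube_proj]) auto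
  next
    fix u v assume "(u, v) \<in> parcs ?H"
    then show "u \<in> pverts ?H \<and> v \<in> pverts ?H \<and> u \<noteq> v"
      unfolding arcs_mk_symmetric_cube_graph by (simp add: cube_graph_arcD)
  next
    fix u v w assume "(u, v) \<in> parcs ?H" and w: "w \<in> pverts ?H"
      and hull: "(cube_proj \<circ> cube_vertex) w \<in> convex hull (cube_proj \<circ> cube_vertex) ` {u, v}"
    then obtain B where B: "cube_edge {u, v} B"
      unfolding arcs_mk_symmetric_cube_graph by (elim cube_graph_edge)
    have "cube_proj (cube_vertex w) \<in> cube_proj ` B" using cube_edge_hull [OF B] hull by auto
    then have "cube_vertex w \<in> B"
      using inj_on_image_mem_iff [OF inj_on_cube_proj _ cube_edge_sides [OF B]] sides w by simp
    then show "w \<in> {u, v}" using cube_edge_vertex [OF B] w by (simp add: verts_cube_graph)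
  next
    fix u v x y assume "(u, v) \<in> parcs ?H" "(x, y) \<in> parcs ?H" and ne: "{u, v} \<noteq> {x, y}"
    then have arcs: "(u, v) \<in> parcs cube_graph" "(x, y) \<in> parcs cube_graph"
      unfolding arcs_mk_symmetric_cube_graph by simp_all
    obtain B B' where B: "cube_edge {u, v} B" "cube_edge {x, y} B'"
      using cube_graph_edge [OF arcs(1)] cube_graph_edge [OF arcs(2)] by metis
    have "cube_proj ` B \<inter> cube_proj ` B' = cube_proj ` (B \<inter> B')"
      by (rule inj_on_image_Int [OF inj_on_cube_proj cube_edge_sides [OF B(1)] cube_edge_sides [OF B(2)], symmetric])
    also have "\<dots> \<subseteq> cube_proj ` cube_vertex ` ({u, v} \<inter> {x, y})"
      using cube_edge_Int [OF B ne] by (rule image_mono)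
    finally show "convex hull (cube_proj \<circ> cube_vertex) ` {u, v} \<inter> convex hull (cube_proj \<circ> cube_vertex) ` {x, y}
        \<subseteq> (cube_proj \<circ> cube_vertex) ` ({u, v} \<inter> {x, y})"
      using cube_edge_hull [OF B(1)] cube_edge_hull [OF B(2)] unfolding image_comp by blast
  qed
  then show ?thesis unfolding planar_def by blast
qed

section \<open>Planar lower intervals\<close>

lemma lower_bruhat_graph_arcD:
  assumes "(\<tau>, \<rho>) \<in> parcs (mk_symmetric (lower_bruhat_graph n \<sigma>))"
  shows "\<tau> \<in> verts (lower_bruhat_graph n \<sigma>)" "\<rho> \<in> verts (lower_bruhat_graph n \<sigma>)" "\<tau> \<noteq> \<rho>"
  using assms unfolding arc_mk_symmetric_lower_bruhat_graph
  by (auto simp: bruhat_step_def)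

text \<open>Expresses adjacency of subsets as distance 1 of their 0/1 vectors, the form in which the
  square and the cube are defined.\<close>

lemma differ_by_one_iff:
  assumes "finite A" "S \<subseteq> A" "T \<subseteq> A"
  shows "(\<Sum>i\<in>A. \<bar>of_bool (i \<in> S) - of_bool (i \<in> T)\<bar> :: int) = 1 \<longleftrightarrow>
    (\<exists>i. i \<notin> S \<and> T = insert i S) \<or> (\<exists>i. i \<notin> T \<and> S = insert i T)"
proof -
  have "(\<Sum>i\<in>A. \<bar>of_bool (i \<in> S) - of_bool (i \<in> T)\<bar> :: int) = (\<Sum>i\<in>A. of_bool ((i \<in> S) \<noteq> (i \<in> T)))"
    by (intro sum.cong) auto
  also have "\<dots> = int (card (A \<inter> {i. (i \<in> S) \<noteq> (i \<in> T)}))"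
    using assms(1) by (simp only: sum_of_bool_eq)
  also have "\<dots> = 1 \<longleftrightarrow> (\<exists>i. A \<inter> {i. (i \<in> S) \<noteq> (i \<in> T)} = {i})"
    unfolding card_1_singleton_iff [symmetric] by simp
  also have "\<dots> \<longleftrightarrow> (\<exists>i. i \<notin> S \<and> T = insert i S) \<or> (\<exists>i. i \<notin> T \<and> S = insert i T)"
  proof
    assume "\<exists>i. A \<inter> {i. (i \<in> S) \<noteq> (i \<in> T)} = {i}"
    then obtain i where i: "A \<inter> {i. (i \<in> S) \<noteq> (i \<in> T)} = {i}" ..
    then have *: "(i \<in> S) \<noteq> (i \<in> T)" "\<And>j. j \<noteq> i \<Longrightarrow> j \<in> S \<longleftrightarrow> j \<in> T"
      using assms(2,3) by blast+
    show "(\<exists>i. i \<notin> S \<and> T = insert i S) \<or> (\<exists>i. i \<notin> T \<and> S = insert i T)"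
    proof (cases "i \<in> S")
      case True
      then have "i \<notin> T \<and> S = insert i T" using * by (metis insert_iff subsetI subset_antisym)
      then show ?thesis by blast
    next
      case False
      then have "i \<notin> S \<and> T = insert i S" using * by (metis insert_iff subsetI subset_antisym)
      then show ?thesis by blast
    qed
  next
    assume "(\<exists>i. i \<notin> S \<and> T = insert i S) \<or> (\<exists>i. i \<notin> T \<and> S = insert i T)"
    then obtain i where "i \<notin> S \<and> T = insert i S \<or> i \<notin> T \<and> S = insert i T" by blast
    then have "A \<inter> {i. (i \<in> S) \<noteq> (i \<in> T)} = {i}"
    proof
      assume "i \<notin> S \<and> T = insert i S"
      then show ?thesis using assms(3) by blast
    next
      assume "i \<notin> T \<and> S = insert i T"
      then show ?thesis using assms(2) by blast
    qed
    then show "\<exists>i. A \<inter> {i. (i \<in> S) \<noteq> (i \<in> T)} = {i}" ..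
  qed
  finally show ?thesis .
qed

lemma bij_betw_adj_support:
  assumes "distinct is" "set is \<subseteq> {1..<n}"
  shows "bij_betw adj_support (verts (lower_bruhat_graph n (adj_word_prod is))) (Pow (set is))"
proof (rule bij_betw_byWitness [where f' = "subword_prod is"])
  note V = bruhat_interval_distinct [OF assms, folded verts_lower_bruhat_graph]
  show "\<forall>\<tau>\<in>verts (lower_bruhat_graph n (adj_word_prod is)). subword_prod is (adj_support \<tau>) = \<tau>"
    unfolding V using assms(1) by (auto simp: adj_support_subword_prod Int_absorb2)
  show "\<forall>S\<in>Pow (set is). adj_support (subword_prod is S) = S"
    using assms(1) by (auto simp: adj_support_subword_prod)
  show "adj_support ` verts (lower_bruhat_graph n (adj_word_prod is)) \<subseteq> Pow (set is)"
    unfolding V using assms(1) by (auto simp: adj_support_subword_prod)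
  show "subword_prod is ` Pow (set is) \<subseteq> verts (lower_bruhat_graph n (adj_word_prod is))"
    unfolding V ..
qed

lemma arc_lower_bruhat_graph_subword_prod:
  assumes "distinct is" "set is \<subseteq> {1..<n}" "S \<subseteq> set is" "T \<subseteq> set is"
  shows "(subword_prod is S, subword_prod is T) \<in> parcs (mk_symmetric (lower_bruhat_graph n (adj_word_prod is)))
    \<longleftrightarrow> (\<Sum>i\<in>set is. \<bar>of_bool (i \<in> S) - of_bool (i \<in> T)\<bar> :: int) = 1"
proof -
  have "bruhat_le n (subword_prod is U) (adj_word_prod is)" if "U \<subseteq> set is" for U
    using bruhat_interval_distinct [OF assms(1,2)] that by blast
  then show ?thesis
    using assms(3,4)
    unfolding arc_mk_symmetric_lower_bruhat_graph differ_by_one_iff [OF finite_set assms(3,4)]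
      bruhat_step_subword_prod [OF assms] bruhat_step_subword_prod [OF assms(1,2,4,3)] by blast
qed

text \<open>Removes permutations from the comparison: it remains to match subsets of the letters
  with the vertices of H, where g assigns coordinates to a subset.\<close>

lemma undirected_iso_distinct:
  assumes "distinct is" "set is \<subseteq> {1..<n}"
    and bij: "bij_betw g (Pow (set is)) (verts H)"
    and H: "\<And>x y. (x, y) \<in> parcs (mk_symmetric H) \<Longrightarrow> x \<in> verts H \<and> y \<in> verts H"
    and arcs: "\<And>S T. S \<subseteq> set is \<Longrightarrow> T \<subseteq> set is \<Longrightarrow> (g S, g T) \<in> parcs (mk_symmetric H) \<longleftrightarrow>
      (\<Sum>i\<in>set is. \<bar>of_bool (i \<in> S) - of_bool (i \<in> T)\<bar> :: int) = 1"
  shows "undirected_iso (lower_bruhat_graph n (adj_word_prod is)) H"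
proof (rule undirected_isoI [of "g \<circ> adj_support"])
  let ?G = "lower_bruhat_graph n (adj_word_prod is)"
  show "bij_betw (g \<circ> adj_support) (verts ?G) (verts H)"
    using bij_betw_trans [OF bij_betw_adj_support [OF assms(1,2)] bij] .
  show "u \<in> verts ?G \<and> v \<in> verts ?G" if "(u, v) \<in> parcs (mk_symmetric ?G)" for u v
    using lower_bruhat_graph_arcD [OF that] by blast
  show "(u, v) \<in> parcs (mk_symmetric ?G) \<longleftrightarrow>
      ((g \<circ> adj_support) u, (g \<circ> adj_support) v) \<in> parcs (mk_symmetric H)"
    if "u \<in> verts ?G" "v \<in> verts ?G" for u v
  proof -
    note uv = that
    obtain S T where S: "u = subword_prod is S" "S \<subseteq> set is" and T: "v = subword_prod is T" "T \<subseteq> set is"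
      using uv bruhat_interval_distinct [OF assms(1,2)] unfolding verts_lower_bruhat_graph by blast
    have "adj_support u = S" "adj_support v = T"
      using S T adj_support_subword_prod [OF assms(1)] by auto
    then show ?thesis
      using arc_lower_bruhat_graph_subword_prod [OF assms(1,2) S(2) T(2)] arcs [OF S(2) T(2)]
      unfolding S(1) T(1) by simp
  qed
qed (rule H)

section \<open>Isomorphisms with the point, the edge, the square and the cube\<close>

lemma square_graph_sym: "parcs (mk_symmetric (with_proj square_graph)) = parcs square_graph"
proof -
  have "(v, u) \<in> parcs square_graph" if "(u, v) \<in> parcs square_graph" for u v
  proof -
    obtain a b a' b' where "u = (a, b)" "v = (a', b')" by fastforce
    with that show ?thesis
      by (simp add: square_graph_def abs_minus_commute [of a'] abs_minus_commute [of b'])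
  qed
  then show ?thesis by (fastforce simp: mk_symmetric_def)
qed

lemma square_graph_arc_iff:
  assumes "x \<in> {0, 1} \<times> {0, 1}" "y \<in> {0, 1} \<times> {0, 1}"
  shows "(x, y) \<in> parcs square_graph \<longleftrightarrow> \<bar>fst x - fst y\<bar> + \<bar>snd x - snd y\<bar> = 1"
proof -
  obtain a b a' b' where xy: "x = (a, b)" "y = (a', b')" by fastforce
  have "a \<in> {0, 1}" "b \<in> {0, 1}" "a' \<in> {0, 1}" "b' \<in> {0, 1}"
    using assms unfolding xy mem_Sigma_iff by blast+
  then show ?thesis unfolding xy square_graph_def by simp
qed

lemma cube_graph_arc_iff:
  assumes "x \<in> {0, 1} \<times> {0, 1} \<times> {0, 1}" "y \<in> {0, 1} \<times> {0, 1} \<times> {0, 1}"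
  shows "(x, y) \<in> parcs cube_graph \<longleftrightarrow>
    \<bar>fst x - fst y\<bar> + \<bar>fst (snd x) - fst (snd y)\<bar> + \<bar>snd (snd x) - snd (snd y)\<bar> = 1"
proof -
  obtain a b c a' b' c' where xy: "x = (a, b, c)" "y = (a', b', c')" by (metis prod_cases3)
  have "a \<in> {0, 1}" "b \<in> {0, 1}" "c \<in> {0, 1}" "a' \<in> {0, 1}" "b' \<in> {0, 1}" "c' \<in> {0, 1}"
    using assms unfolding xy mem_Sigma_iff by blast+
  then show ?thesis unfolding xy cube_graph_def by simp
qed

lemma undirected_iso_point_graph:
  "undirected_iso (lower_bruhat_graph n (adj_word_prod [])) (with_proj point_graph)"
proof (rule undirected_iso_distinct [where g = "\<lambda>S. 0"])
  show "bij_betw (\<lambda>S. 0) (Pow (set [])) (verts (with_proj point_graph))"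
    by (simp add: bij_betw_def point_graph_def)
qed (simp_all add: mk_symmetric_def point_graph_def)

lemma undirected_iso_edge_graph:
  assumes "set [a] \<subseteq> {1..<n}"
  shows "undirected_iso (lower_bruhat_graph n (adj_word_prod [a])) (with_proj edge_graph)"
proof (rule undirected_iso_distinct [where g = "\<lambda>S. of_bool (a \<in> S)"])
  show "bij_betw (\<lambda>S. of_bool (a \<in> S)) (Pow (set [a])) (verts (with_proj edge_graph))"
    by (rule bij_betw_byWitness [where f' = "\<lambda>x. if x = 1 then {a} else {}"])
      (auto simp: edge_graph_def)
qed (use assms in \<open>auto simp: mk_symmetric_def edge_graph_def\<close>)

lemma undirected_iso_square_graph:
  assumes "set [a, b] \<subseteq> {1..<n}" "distinct [a, b]"
  shows "undirected_iso (lower_bruhat_graph n (adj_word_prod [a, b])) (with_proj square_graph)"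
proof (rule undirected_iso_distinct [where g = "\<lambda>S. (of_bool (a \<in> S), of_bool (b \<in> S))"])
  show "bij_betw (\<lambda>S. (of_bool (a \<in> S), of_bool (b \<in> S))) (Pow (set [a, b])) (verts (with_proj square_graph))"
    using assms(2)
    by (intro bij_betw_byWitness [where f' = "\<lambda>(x, y). (if x = 1 then {a} else {}) \<union> (if y = 1 then {b} else {})"])
      (auto simp: square_graph_def)
next
  fix x y assume "(x, y) \<in> parcs (mk_symmetric (with_proj square_graph))"
  then show "x \<in> verts (with_proj square_graph) \<and> y \<in> verts (with_proj square_graph)"
    unfolding square_graph_sym by (auto simp: square_graph_def)
next
  fix S T
  show "((of_bool (a \<in> S), of_bool (b \<in> S)), (of_bool (a \<in> T), of_bool (b \<in> T)))
      \<in> parcs (mk_symmetric (with_proj square_graph)) \<longleftrightarrow>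
    (\<Sum>i\<in>set [a, b]. \<bar>of_bool (i \<in> S) - of_bool (i \<in> T)\<bar> :: int) = 1"
    unfolding square_graph_sym using assms(2) by (subst square_graph_arc_iff) auto
qed (use assms in auto)

lemma undirected_iso_cube_graph:
  assumes "set [a, b, c] \<subseteq> {1..<n}" "distinct [a, b, c]"
  shows "undirected_iso (lower_bruhat_graph n (adj_word_prod [a, b, c])) (with_proj cube_graph)"
proof -
  define g :: "nat set \<Rightarrow> int \<times> int \<times> int" where
    "g S = (of_bool (a \<in> S), of_bool (b \<in> S), of_bool (c \<in> S))" for S
  define g' :: "int \<times> int \<times> int \<Rightarrow> nat set" where
    "g' = (\<lambda>(x, y, z). {i. i = a \<and> x = 1 \<or> i = b \<and> y = 1 \<or> i = c \<and> z = 1})"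
  have ne: "a \<noteq> b" "a \<noteq> c" "b \<noteq> c" using assms(2) by auto
  have of_bool: "of_bool p \<in> {0, 1 :: int}" for p by simp
  then have g: "g S \<in> {0, 1} \<times> {0, 1} \<times> {0, 1}" for S
    unfolding g_def mem_Sigma_iff by blast
  show ?thesis
  proof (rule undirected_iso_distinct [where g = g])
    show "bij_betw g (Pow (set [a, b, c])) (verts (with_proj cube_graph))"
    proof (rule bij_betw_byWitness [where f' = g'])
      show "\<forall>S\<in>Pow (set [a, b, c]). g' (g S) = S" by (auto simp: g_def g'_def)
      show "\<forall>p\<in>verts (with_proj cube_graph). g (g' p) = p"
      proof
        fix p assume p: "p \<in> verts (with_proj cube_graph)"
        obtain x y z where xyz: "p = (x, y, z)" by (metis prod_cases3)
        then have "x \<in> {0, 1}" "y \<in> {0, 1}" "z \<in> {0, 1}"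
          using p unfolding with_proj_simps verts_cube_graph xyz mem_Sigma_iff by blast+
        then have "of_bool (x = 1) = x" "of_bool (y = 1) = y" "of_bool (z = 1) = z" by auto
        then show "g (g' p) = p" using ne by (simp add: xyz g_def g'_def)
      qed
      show "g ` Pow (set [a, b, c]) \<subseteq> verts (with_proj cube_graph)"
        using g unfolding with_proj_simps verts_cube_graph by blast
      show "g' ` verts (with_proj cube_graph) \<subseteq> Pow (set [a, b, c])" by (auto simp: g'_def)
    qed
  next
    fix x y assume "(x, y) \<in> parcs (mk_symmetric (with_proj cube_graph))"
    then show "x \<in> verts (with_proj cube_graph) \<and> y \<in> verts (with_proj cube_graph)"
      unfolding arcs_mk_symmetric_cube_graph by (simp add: cube_graph_arcD)
  next
    fix S T
    show "(g S, g T) \<in> parcs (mk_symmetric (with_proj cube_graph)) \<longleftrightarrow>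
      (\<Sum>i\<in>set [a, b, c]. \<bar>of_bool (i \<in> S) - of_bool (i \<in> T)\<bar> :: int) = 1"
      unfolding arcs_mk_symmetric_cube_graph cube_graph_arc_iff [OF g g]
      using ne by (simp add: g_def add.assoc)
  qed (use assms in auto)
qed

section \<open>Planarity of the smaller graphs, as faces of the cube\<close>

lemma planar_point_graph: "planar (with_proj point_graph)"
  by (rule planar_embed [OF planar_cube_graph, of "\<lambda>x. (0, 0, 0)"])
    (auto simp: point_graph_def mk_symmetric_def verts_cube_graph)

lemma planar_edge_graph: "planar (with_proj edge_graph)"
  by (rule planar_embed [OF planar_cube_graph, of "\<lambda>x. (x, 0, 0)"])
    (auto simp: edge_graph_def mk_symmetric_def cube_graph_def inj_on_def)

lemma planar_square_graph: "planar (with_proj square_graph)"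
proof (rule planar_embed [OF planar_cube_graph, of "\<lambda>(x, y). (x, y, 0)"])
  fix u v assume "(u, v) \<in> parcs (mk_symmetric (with_proj square_graph))"
  then show "u \<in> verts (with_proj square_graph) \<and> v \<in> verts (with_proj square_graph) \<and>
      ((case u of (x, y) \<Rightarrow> (x, y, 0)), (case v of (x, y) \<Rightarrow> (x, y, 0)))
        \<in> parcs (mk_symmetric (with_proj cube_graph))"
    unfolding square_graph_sym arcs_mk_symmetric_cube_graph
    by (auto simp: square_graph_def cube_graph_def)
qed (auto simp: square_graph_def cube_graph_def inj_on_def)

text \<open>The subsets of the first four letters span a four-dimensional subcube; \<open>S\<close>
  turns a vector of four truth values into such a subset, and the support makes the resulting
  products distinct.\<close>

lemma long_distinct_word_not_planar:
  assumes "distinct (w # x # y # z # rest)" "set (w # x # y # z # rest) \<subseteq> {1..<n}"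
  shows "\<not> planar (lower_bruhat_graph n (adj_word_prod (w # x # y # z # rest)))"
proof -
  define js where "js = w # x # y # z # rest"
  note js = assms [folded js_def]
  define S where "S = (\<lambda>(p, q, r, s). {i. p \<and> i = w \<or> q \<and> i = x \<or> r \<and> i = y \<or> s \<and> i = z})"
  have sub4: "S t \<subseteq> {w, x, y, z}" for t by (cases t) (auto simp: S_def)
  have sub: "S t \<subseteq> set js" for t using sub4 [of t] by (auto simp: js_def)
  have ne: "w \<noteq> x" "w \<noteq> y" "w \<noteq> z" "x \<noteq> y" "x \<noteq> z" "y \<noteq> z" using assms(1) by auto
  have mem: "w \<in> S (p, q, r, s) \<longleftrightarrow> p" "x \<in> S (p, q, r, s) \<longleftrightarrow> q"
    "y \<in> S (p, q, r, s) \<longleftrightarrow> r" "z \<in> S (p, q, r, s) \<longleftrightarrow> s" for p q r s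
    using ne by (simp_all add: S_def)
  have "inj S"
  proof (rule injI)
    fix t t' assume eq: "S t = S t'"
    obtain p q r s p' q' r' s' where t: "t = (p, q, r, s)" "t' = (p', q', r', s')" by (metis prod_cases4)
    show "t = t'" using mem [of p q r s] mem [of p' q' r' s'] eq unfolding t by simp
  qed
  have "inj (\<lambda>t. subword_prod js (S t))"
  proof (rule injI)
    fix t t' assume "subword_prod js (S t) = subword_prod js (S t')"
    then have "S t \<inter> set js = S t' \<inter> set js"
      using adj_support_subword_prod [OF js(1)] by metis
    then show "t = t'" using \<open>inj S\<close> sub [of t] sub [of t'] by (simp add: Int_absorb2 inj_eq)
  qed
  note inj = this
  show ?thesis
    unfolding js_def [symmetric]
  proof (rule tesseract_not_planar [OF _ inj])
    show "(v, v) \<notin> parcs (mk_symmetric (lower_bruhat_graph n (adj_word_prod js)))" for v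
      using lower_bruhat_graph_arcD(3) by blast
    show "range (\<lambda>t. subword_prod js (S t)) \<subseteq> verts (lower_bruhat_graph n (adj_word_prod js))"
      using bruhat_interval_distinct [OF js] sub unfolding verts_lower_bruhat_graph by blast
  next
    fix t t' assume t: "hamming4 t t' = 1"
    \<comment> \<open>Letters beyond the first four belong to no \<open>S t\<close> and contribute 0
      to the distance.\<close>
    have "(\<Sum>i\<in>set js. \<bar>of_bool (i \<in> S t) - of_bool (i \<in> S t')\<bar> :: int) =
        (\<Sum>i\<in>{w, x, y, z}. \<bar>of_bool (i \<in> S t) - of_bool (i \<in> S t')\<bar>)"
    proof (rule sum.mono_neutral_right)
      show "{w, x, y, z} \<subseteq> set js" by (auto simp: js_def)
      show "\<forall>i\<in>set js - {w, x, y, z}. \<bar>of_bool (i \<in> S t) - of_bool (i \<in> S t')\<bar> = (0 :: int)"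
      proof
        fix i assume "i \<in> set js - {w, x, y, z}"
        then have "i \<notin> S t" "i \<notin> S t'" using sub4 by blast+
        then show "\<bar>of_bool (i \<in> S t) - of_bool (i \<in> S t')\<bar> = (0 :: int)" by simp
      qed
    qed simp
    also have "\<dots> = int (hamming4 t t')"
    proof -
      obtain p q r s p' q' r' s' where tt: "t = (p, q, r, s)" "t' = (p', q', r', s')" by (metis prod_cases4)
      have "\<bar>of_bool P - of_bool Q\<bar> = (of_bool (P \<noteq> Q) :: int)" for P Q by (cases P; cases Q) simp_all
      then show ?thesis unfolding tt using ne by (simp add: mem hamming4_def)
    qed
    finally show "(subword_prod js (S t), subword_prod js (S t'))
        \<in> parcs (mk_symmetric (lower_bruhat_graph n (adj_word_prod js)))"
      unfolding arc_lower_bruhat_graph_subword_prod [OF js sub sub] t by simp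
  qed
qed

theorem corollary3p2:
  fixes n :: nat and \<sigma> :: "nat \<Rightarrow> nat"
  assumes "n \<ge> 1" and "\<sigma> permutes {1..n}"
  shows "planar (lower_bruhat_graph n \<sigma>) \<longleftrightarrow>
      undirected_iso (lower_bruhat_graph n \<sigma>) (with_proj point_graph) \<or>
      undirected_iso (lower_bruhat_graph n \<sigma>) (with_proj edge_graph) \<or>
      undirected_iso (lower_bruhat_graph n \<sigma>) (with_proj square_graph) \<or>
      undirected_iso (lower_bruhat_graph n \<sigma>) (with_proj cube_graph)"
proof
  assume planar: "planar (lower_bruhat_graph n \<sigma>)"
  obtain js where js: "set js \<subseteq> {1..<n}" "\<sigma> = adj_word_prod js" "length js = perm_length n \<sigma>"
    using perm_length_word [OF assms(2)] .
  then have red: "reduced_word n js" by (simp add: reduced_word_def)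
  have dist: "distinct js"
  proof (rule ccontr)
    assume "\<not> distinct js"
    then obtain i j where "j = Suc i \<or> i = Suc j" "subseq [i, j, i] js"
      using reduced_word_not_distinct [OF red] by blast
    then obtain a0 a1 a2 b0 b1 b2 where K: "distinct [a0, a1, a2, b0, b1, b2]"
      "\<forall>a\<in>{a0, a1, a2}. \<forall>b\<in>{b0, b1, b2}. (a, b) \<in> parcs (mk_symmetric (lower_bruhat_graph n \<sigma>))"
      using lower_bruhat_graph_K33 [OF red] js(2) by metis
    have "{a0, a1, a2, b0, b1, b2} \<subseteq> verts (lower_bruhat_graph n \<sigma>)"
      using K(2) lower_bruhat_graph_arcD(1,2) by blast
    then show False
      using K33_not_planar [OF _ _ K] lower_bruhat_graph_arcD(3) planar by blast
  qed
  consider "js = []" | a where "js = [a]" | a b where "js = [a, b]" | a b c where "js = [a, b, c]"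
    | w x y z rest where "js = w # x # y # z # rest"
    by (metis list.exhaust)
  then show "undirected_iso (lower_bruhat_graph n \<sigma>) (with_proj point_graph) \<or>
      undirected_iso (lower_bruhat_graph n \<sigma>) (with_proj edge_graph) \<or>
      undirected_iso (lower_bruhat_graph n \<sigma>) (with_proj square_graph) \<or>
      undirected_iso (lower_bruhat_graph n \<sigma>) (with_proj cube_graph)"
  proof cases
    case 1
    show ?thesis unfolding js(2) 1 using undirected_iso_point_graph by blast
  next
    case 2
    show ?thesis using undirected_iso_edge_graph js(1) unfolding js(2) 2 by blast
  next
    case 3
    show ?thesis using undirected_iso_square_graph js(1) dist unfolding js(2) 3 by blast
  next
    case 4
    show ?thesis using undirected_iso_cube_graph js(1) dist unfolding js(2) 4 by blast
  next
    case 5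
    then show ?thesis using long_distinct_word_not_planar js(1,2) dist planar by blast
  qed
qed (elim disjE; erule planar_undirected_iso,
    rule planar_point_graph planar_edge_graph planar_square_graph planar_cube_graph)

end
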